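(* Let $k$ be a field, let $n_1,n_2,m_1,m_2$ be positive integers, and let $L_n/K_n$ be the general field extension of degree $n=n_1+n_2$ over $k$. Suppose that (i) $n_1n_2\ne 0$ and $\left(-\frac{n_2}{n_1}\right)^{m_2-m_1}\neq 1$ in $k$; and (ii) for each $i=1,2$, $\operatorname{sqf}(n_i)$ divides $m_1$ or $m_2$ (and possibly both). Then the system of equations $$\operatorname{tr}(x^{m_1})=\operatorname{tr}(x^{m_2})=0$$ has no solutions $x\in L_n^*$.
   Context: The general field extension $L_n/K_n$ over $k$ is $K_n=k(a_1,\dots,a_n)$, $L_n=K_n[x]/(x^n+a_1x^{n-1}+\dots+a_n)$, where $a_1,\dots,a_n$ are algebraically independent indeterminates over $k$. $\operatorname{tr}$ denotes the trace of $L_n/K_n$, and $L_n^*=L_n-\{0\}$. $\operatorname{sqf}(N)$ denotes the product of the distinct primes dividing $N$ (so $\operatorname{sqf}(1)=1$). *)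

theory Defs
  imports
    "HOL-Computational_Algebra.Computational_Algebra"
    "HOL-Library.Cardinality"
    "HOL-Library.Poly_Mapping"
begin

section \<open>The radical of a natural number\<close>

definition sqf :: "nat \<Rightarrow> nat" where
  "sqf N = \<Prod>(prime_factors N)"

lemma sqf_1: "sqf 1 = 1"
  by (simp add: sqf_def)


section \<open>The trace of an endomorphism\<close>

text \<open>
  The diagonal sum of the matrix with respect to a chosen basis. It does not depend on the
  choice if there is a finite basis (lemma \<open>lin_trace_eq\<close>); in infinite dimension
  the value has no meaning.
\<close>

definition lin_trace ::
  "('a::field \<Rightarrow> 'b::ab_group_add \<Rightarrow> 'b) \<Rightarrow> ('b \<Rightarrow> 'b) \<Rightarrow> 'a" where
  "lin_trace scale T =
    (let B = vector_space.extend_basis scale {}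
     in \<Sum>b\<in>B. module.representation scale B (T b) b)"

context vector_space
begin

lemma diag_sum_basis_independent:
  assumes B: "finite B" "independent B" "span B = UNIV"
    and C: "finite C" "independent C" "span C = UNIV"
    and T: "Vector_Spaces.linear scale scale T"
  shows "(\<Sum>b\<in>B. representation B (T b) b) = (\<Sum>c\<in>C. representation C (T c) c)"
proof -
  have T_sum: "T (\<Sum>a\<in>A. f a *s a) = (\<Sum>a\<in>A. f a *s T a)" for A f
  proof -
    interpret T: Vector_Spaces.linear scale scale T by fact
    show ?thesis by (simp add: T.sum T.scale)
  qed
  have rep: "representation D (T v) d = (\<Sum>e\<in>E. representation E v e * representation D (T e) d)"
    if "independent D" "span D = UNIV" "finite E" "independent E" "span E = UNIV"
    for D E v d
  proof -
    have "v = (\<Sum>e\<in>E. representation E v e *s e)"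
      using that by (intro sum_representation_eq[symmetric]) auto
    then have "T v = (\<Sum>e\<in>E. representation E v e *s T e)"
      by (subst T_sum[symmetric]) (rule arg_cong[where f = T])
    then show ?thesis
      using that by (simp add: representation_sum representation_scale)
  qed
  have repT: "representation D w d = (\<Sum>e\<in>E. representation E w e * representation D e d)"
    if "independent D" "span D = UNIV" "finite E" "independent E" "span E = UNIV"
    for D E w d
  proof -
    have "w = (\<Sum>e\<in>E. representation E w e *s e)"
      using that by (intro sum_representation_eq[symmetric]) auto
    then have "representation D w d = representation D (\<Sum>e\<in>E. representation E w e *s e) d"
      by (rule arg_cong[where f = "\<lambda>v. representation D v d"])
    also have "\<dots> = (\<Sum>e\<in>E. representation E w e * representation D e d)"
      using that by (simp add: representation_sum representation_scale)
    finally show ?thesis .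
  qed
  have "(\<Sum>b\<in>B. representation B (T b) b)
      = (\<Sum>b\<in>B. \<Sum>c\<in>C. representation C b c * representation B (T c) b)"
    by (intro sum.cong refl rep B C)
  also have "\<dots> = (\<Sum>c\<in>C. \<Sum>b\<in>B. representation B (T c) b * representation C b c)"
    by (subst sum.swap) (simp add: mult.commute)
  also have "\<dots> = (\<Sum>c\<in>C. representation C (T c) c)"
    by (intro sum.cong refl repT[symmetric] B C)
  finally show ?thesis .
qed

lemma lin_trace_eq:
  assumes B: "finite B" "independent B" "span B = UNIV"
    and T: "Vector_Spaces.linear scale scale T"
  shows "lin_trace scale T = (\<Sum>b\<in>B. representation B (T b) b)"
proof -
  have ind: "independent (extend_basis {})" and sp: "span (extend_basis {}) = UNIV"
    by (simp_all add: independent_extend_basis span_extend_basis independent_empty)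
  have "finite (extend_basis {})"
    using independent_span_bound[OF B(1) ind] B(3) by auto
  then show ?thesis
    unfolding lin_trace_def Let_def
    by (rule diag_sum_basis_independent[OF _ ind sp B T])
qed

end


section \<open>The general field extension of degree \<open>n\<close>\<close>

text \<open>
  The degree \<open>n\<close> is given by a finite type \<open>'n\<close> with \<open>n = CARD('n)\<close>, so that the two fields
  are types. The elements of \<open>'n\<close> play no role: the indeterminates are
  indexed by a copy of \<open>{1..n}\<close>, whose linear order is used only to obtain that
  polynomials form an integral domain.
\<close>

typedef ('n::finite) var_index = "{1..CARD('n)}"
  morphisms nat_of_index index_of_nat
  by (rule exI[of _ 1]) (simp add: Suc_le_eq)

setup_lifting type_definition_var_index

instantiation var_index :: (finite) linorder
begin

lift_definition less_eq_var_index :: "'a var_index \<Rightarrow> 'a var_index \<Rightarrow> bool" is "(\<le>)" .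
lift_definition less_var_index :: "'a var_index \<Rightarrow> 'a var_index \<Rightarrow> bool" is "(<)" .

instance
  by standard (transfer, force)+

end

text \<open>Polynomials over \<open>'k\<close> in \<open>n\<close> indeterminates: a monomial is a map from
  indeterminates to exponents.\<close>

type_synonym ('k, 'n) gen_mpoly = "('n var_index \<Rightarrow>\<^sub>0 nat) \<Rightarrow>\<^sub>0 'k"

text \<open>The field \<open>K\<^sub>n = k(a\<^sub>1, \<dots>, a\<^sub>n)\<close>.\<close>

type_synonym ('k, 'n) gen_base = "('k, 'n) gen_mpoly fract"

text \<open>The indeterminate \<open>a\<^sub>i\<close>, meaningful for \<open>1 \<le> i \<le> n\<close> only.\<close>

definition gen_coeff :: "nat \<Rightarrow> ('k::field, 'n::finite) gen_base" where
  "gen_coeff i = Fract (Poly_Mapping.single (Poly_Mapping.single (index_of_nat i) 1) 1) 1"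

definition gen_poly :: "('k::field, 'n::finite) gen_base poly" where
  "gen_poly = monom 1 CARD('n) + (\<Sum>i = 1..CARD('n). monom (gen_coeff i) (CARD('n) - i))"

lemma degree_gen_poly_tail:
  "degree (\<Sum>i = 1..CARD('n). monom (gen_coeff i :: ('k::field, 'n::finite) gen_base) (CARD('n) - i))
    < CARD('n)"
proof -
  have "degree (\<Sum>i = 1..CARD('n). monom (gen_coeff i :: ('k, 'n) gen_base) (CARD('n) - i))
      \<le> CARD('n) - 1"
    by (intro degree_sum_le order_trans[OF degree_monom_le]) auto
  then show ?thesis
    by (meson diff_less le_less_trans zero_less_card_finite zero_less_one)
qed

lemma degree_gen_poly: "degree (gen_poly :: ('k::field, 'n::finite) gen_base poly) = CARD('n)"
  unfolding gen_poly_def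
  using degree_gen_poly_tail[where 'k = 'k and 'n = 'n]
  by (subst degree_add_eq_left) (simp_all add: degree_monom_eq)

lemma gen_poly_nonzero: "gen_poly \<noteq> (0 :: ('k::field, 'n::finite) gen_base poly)"
proof
  assume "gen_poly = (0 :: ('k, 'n) gen_base poly)"
  then have "CARD('n) = 0"
    by (metis degree_0 degree_gen_poly)
  then show False
    by simp
qed

text \<open>The \<open>K\<^sub>n\<close>-algebra \<open>L\<^sub>n = K\<^sub>n[x]/(gen_poly)\<close>.\<close>

quotient_type (overloaded) ('k, 'n) gen_ext =
  "('k::field, 'n::finite) gen_base poly" / "\<lambda>p q. gen_poly dvd p - q"
  morphisms rep_gen_ext gen_class
proof (rule equivpI)
  show "reflp (\<lambda>p q. (gen_poly :: ('k, 'n) gen_base poly) dvd p - q)"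
    by (simp add: reflp_def)
  show "symp (\<lambda>p q. (gen_poly :: ('k, 'n) gen_base poly) dvd p - q)"
    by (auto simp: symp_def dvd_diff_commute)
  show "transp (\<lambda>p q. (gen_poly :: ('k, 'n) gen_base poly) dvd p - q)"
  proof (rule transpI)
    fix p q r :: "('k, 'n) gen_base poly"
    assume "gen_poly dvd p - q" "gen_poly dvd q - r"
    then have "gen_poly dvd (p - q) + (q - r)"
      by (rule dvd_add)
    then show "gen_poly dvd p - r"
      by simp
  qed
qed

lemma gen_poly_dvd_diff_eq: "p = q \<Longrightarrow> gen_poly dvd p - q"
  by simp

instantiation gen_ext :: (field, finite) comm_ring_1
begin

lift_definition zero_gen_ext :: "('a, 'b) gen_ext" is 0 .
lift_definition one_gen_ext :: "('a, 'b) gen_ext" is 1 .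

lift_definition plus_gen_ext :: "('a, 'b) gen_ext \<Rightarrow> ('a, 'b) gen_ext \<Rightarrow> ('a, 'b) gen_ext" is "(+)"
  by (simp add: add_diff_add)

lift_definition uminus_gen_ext :: "('a, 'b) gen_ext \<Rightarrow> ('a, 'b) gen_ext" is uminus
  by (simp only: minus_diff_minus dvd_minus_iff)

lift_definition minus_gen_ext :: "('a, 'b) gen_ext \<Rightarrow> ('a, 'b) gen_ext \<Rightarrow> ('a, 'b) gen_ext" is "(-)"
proof -
  fix p q r s :: "('a, 'b) gen_base poly"
  assume "gen_poly dvd p - q" "gen_poly dvd r - s"
  then have "gen_poly dvd (p - q) - (r - s)"
    by (rule dvd_diff)
  also have "(p - q) - (r - s) = (p - r) - (q - s)"
    by simp
  finally show "gen_poly dvd (p - r) - (q - s)" .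
qed

lift_definition times_gen_ext :: "('a, 'b) gen_ext \<Rightarrow> ('a, 'b) gen_ext \<Rightarrow> ('a, 'b) gen_ext" is "(*)"
  by (simp only: mult_diff_mult dvd_add dvd_mult dvd_mult2)

instance
proof
  show "(0 :: ('a, 'b) gen_ext) \<noteq> 1"
  proof (transfer, rule notI)
    assume "(gen_poly :: ('a, 'b) gen_base poly) dvd 0 - 1"
    then have "is_unit (gen_poly :: ('a, 'b) gen_base poly)"
      by simp
    then have "degree (gen_poly :: ('a, 'b) gen_base poly) = 0"
      by (simp add: is_unit_iff_degree gen_poly_nonzero)
    then show False
      by (simp add: degree_gen_poly)
  qed
  fix x y z :: "('a, 'b) gen_ext"
  show "x * y * z = x * (y * z)"
    by transfer (rule gen_poly_dvd_diff_eq, rule mult.assoc)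
  show "x * y = y * x"
    by transfer (rule gen_poly_dvd_diff_eq, rule mult.commute)
  show "1 * x = x"
    by transfer (rule gen_poly_dvd_diff_eq, rule mult_1_left)
  show "x + y + z = x + (y + z)"
    by transfer (rule gen_poly_dvd_diff_eq, rule add.assoc)
  show "x + y = y + x"
    by transfer (rule gen_poly_dvd_diff_eq, rule add.commute)
  show "0 + x = x"
    by transfer (rule gen_poly_dvd_diff_eq, rule add_0_left)
  show "- x + x = 0"
    by transfer (rule gen_poly_dvd_diff_eq, rule left_minus)
  show "x - y = x + - y"
    by transfer (rule gen_poly_dvd_diff_eq, rule diff_conv_add_uminus)
  show "(x + y) * z = x * z + y * z"
    by transfer (rule gen_poly_dvd_diff_eq, rule distrib_right)
qed

end

definition gen_scale ::
  "('k::field, 'n::finite) gen_base \<Rightarrow> ('k, 'n) gen_ext \<Rightarrow> ('k, 'n) gen_ext" where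
  "gen_scale c x = gen_class [:c:] * x"

interpretation gen_ext: vector_space gen_scale
proof
  fix a b :: "('k::field, 'n::finite) gen_base" and x y :: "('k, 'n) gen_ext"
  show "gen_scale a (x + y) = gen_scale a x + gen_scale a y"
    by (simp add: gen_scale_def algebra_simps)
  have "gen_class [:a + b:] = (gen_class [:a:] + gen_class [:b:] :: ('k, 'n) gen_ext)"
    by (simp add: plus_gen_ext.abs_eq)
  then show "gen_scale (a + b) x = gen_scale a x + gen_scale b x"
    by (simp add: gen_scale_def algebra_simps)
  have "gen_class [:a * b:] = (gen_class [:a:] * gen_class [:b:] :: ('k, 'n) gen_ext)"
    by (simp add: times_gen_ext.abs_eq mult.commute)
  then show "gen_scale a (gen_scale b x) = gen_scale (a * b) x"
    by (simp add: gen_scale_def algebra_simps)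
  have "gen_class [:1:] = (1 :: ('k, 'n) gen_ext)"
    by (simp add: one_gen_ext_def flip: one_pCons)
  then show "gen_scale 1 x = x"
    by (simp add: gen_scale_def)
qed

text \<open>The trace of \<open>L\<^sub>n/K\<^sub>n\<close>: that of multiplication by the given element.\<close>

definition gen_trace :: "('k::field, 'n::finite) gen_ext \<Rightarrow> ('k, 'n) gen_base" where
  "gen_trace x = lin_trace gen_scale (\<lambda>y. x * y)"

definition gen_power_basis :: "('k::field, 'n::finite) gen_ext set" where
  "gen_power_basis = (\<lambda>j. gen_class (monom 1 j)) ` {..<CARD('n)}"

lemma gen_class_sum: "gen_class (\<Sum>j\<in>A. f j) = (\<Sum>j\<in>A. gen_class (f j))"
  by (induction A rule: infinite_finite_induct)
     (simp_all add: zero_gen_ext.abs_eq[symmetric] plus_gen_ext.abs_eq[symmetric])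

lemma gen_scale_class: "gen_scale c (gen_class p) = gen_class (smult c p)"
  by (simp add: gen_scale_def times_gen_ext.abs_eq)

lemma gen_class_eq_0_iff:
  "gen_class p = (0 :: ('k::field, 'n::finite) gen_ext) \<longleftrightarrow> gen_poly dvd p"
  by transfer simp

lemma inj_on_gen_class_monom:
  "inj_on (\<lambda>j. gen_class (monom 1 j) :: ('k::field, 'n::finite) gen_ext) {..<CARD('n)}"
proof (rule inj_onI)
  fix i j assume ij: "i \<in> {..<CARD('n)}" "j \<in> {..<CARD('n)}"
    and "gen_class (monom 1 i) = (gen_class (monom 1 j) :: ('k, 'n) gen_ext)"
  then have dvd: "(gen_poly :: ('k, 'n) gen_base poly) dvd monom 1 i - monom 1 j"
    by (simp only: gen_ext.abs_eq_iff)
  have "degree (monom 1 i - monom 1 j :: ('k, 'n) gen_base poly) < CARD('n)"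
    using ij by (intro degree_diff_less) (simp_all add: degree_monom_eq)
  then have "monom 1 i - monom 1 j = (0 :: ('k, 'n) gen_base poly)"
    using dvd_imp_degree_le[OF dvd] unfolding degree_gen_poly by (meson not_le)
  then have "degree (monom 1 i :: ('k, 'n) gen_base poly) = degree (monom 1 j :: ('k, 'n) gen_base poly)"
    by simp
  then show "i = j"
    by (simp add: degree_monom_eq)
qed

lemma finite_gen_power_basis: "finite gen_power_basis"
  by (simp add: gen_power_basis_def)

lemma card_gen_power_basis: "card (gen_power_basis :: ('k::field, 'n::finite) gen_ext set) = CARD('n)"
  unfolding gen_power_basis_def by (simp add: card_image inj_on_gen_class_monom)

lemma independent_gen_power_basis:
  "gen_ext.independent (gen_power_basis :: ('k::field, 'n::finite) gen_ext set)"
proof (rule gen_ext.independent_if_scalars_zero)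
  fix f and x :: "('k, 'n) gen_ext"
  assume sum0: "(\<Sum>x\<in>gen_power_basis. gen_scale (f x) x) = (0 :: ('k, 'n) gen_ext)"
    and x: "x \<in> gen_power_basis"
  let ?c = "\<lambda>j. f (gen_class (monom 1 j))"
  let ?p = "\<Sum>j<CARD('n). monom (?c j) j"
  have "gen_class ?p = (0 :: ('k, 'n) gen_ext)"
    using sum0 unfolding gen_power_basis_def
    by (simp add: sum.reindex inj_on_gen_class_monom gen_scale_class gen_class_sum smult_monom)
  then have dvd: "gen_poly dvd ?p"
    by (simp add: gen_class_eq_0_iff)
  have "degree ?p \<le> CARD('n) - 1"
    by (intro degree_sum_le order_trans[OF degree_monom_le]) auto
  then have "degree ?p < CARD('n)"
    by (meson diff_less le_less_trans zero_less_card_finite zero_less_one)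
  then have p0: "?p = 0"
    using dvd_imp_degree_le[OF dvd] by (auto simp: degree_gen_poly)
  obtain j where j: "j < CARD('n)" "x = gen_class (monom 1 j)"
    using x by (auto simp: gen_power_basis_def)
  have "coeff ?p j = ?c j"
    using j by (simp add: coeff_sum)
  then show "f x = 0"
    using p0 j by simp
qed (rule finite_gen_power_basis)

lemma span_gen_power_basis:
  "gen_ext.span (gen_power_basis :: ('k::field, 'n::finite) gen_ext set) = UNIV"
proof (intro equalityI subset_UNIV subsetI)
  fix x :: "('k, 'n) gen_ext"
  define q where "q = rep_gen_ext x mod gen_poly"
  have "degree q < CARD('n)"
    using degree_mod_less[OF gen_poly_nonzero, of "rep_gen_ext x"]
    by (auto simp: q_def degree_gen_poly)
  then have q: "q = (\<Sum>j<CARD('n). monom (coeff q j) j)"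
    by (intro poly_eqI) (auto simp: coeff_sum coeff_eq_0)
  have "x = gen_class (rep_gen_ext x)"
    by (simp add: Quotient3_abs_rep[OF Quotient3_gen_ext])
  also have "\<dots> = gen_class q"
    unfolding q_def gen_ext.abs_eq_iff by (simp add: minus_mod_eq_mult_div)
  also have "\<dots> = (\<Sum>j<CARD('n). gen_scale (coeff q j) (gen_class (monom 1 j)))"
    by (subst q) (simp add: gen_class_sum gen_scale_class smult_monom)
  also have "\<dots> \<in> gen_ext.span gen_power_basis"
    by (intro gen_ext.span_sum gen_ext.span_scale gen_ext.span_base)
       (auto simp: gen_power_basis_def)
  finally show "x \<in> gen_ext.span gen_power_basis" .
qed

lemma dim_gen_ext: "gen_ext.dim (UNIV :: ('k::field, 'n::finite) gen_ext set) = CARD('n)"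
  using gen_ext.dim_span_eq_card_independent[OF independent_gen_power_basis]
  by (simp add: span_gen_power_basis card_gen_power_basis)

lemma linear_times_gen_ext:
  "Vector_Spaces.linear gen_scale gen_scale (\<lambda>y. x * y :: ('k::field, 'n::finite) gen_ext)"
  by unfold_locales (simp_all add: gen_scale_def algebra_simps)

lemma gen_trace_eq:
  fixes x :: "('k::field, 'n::finite) gen_ext"
  assumes "finite B" "gen_ext.independent B" "gen_ext.span B = UNIV"
  shows "gen_trace x = (\<Sum>b\<in>B. gen_ext.representation B (x * b) b)"
  unfolding gen_trace_def using assms linear_times_gen_ext by (rule gen_ext.lin_trace_eq)

end

theory Submission
  imports "HOL-Algebra.Algebraic_Closure_Type" Defs
begin

text \<open>
  Write \<open>n\<^sub>1\<close> and \<open>n\<^sub>2\<close> as products of primes, take one variable \<open>z\<^sub>l\<close> for each prime \<open>p\<^sub>l\<close>, and let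
  \<open>T\<^sub>i\<close>, of order \<open>n\<^sub>i\<close>, be the group of tuples of \<open>p\<^sub>l\<close>-th roots of unity belonging to \<open>n\<^sub>i\<close>. It acts
  on polynomials over an algebraically closed field by scaling the variables. The extension \<open>L\<^sub>n/K\<^sub>n\<close>
  specialises to a product of two multi-Kummer algebras with groups \<open>T\<^sub>1\<close> and \<open>T\<^sub>2\<close>; a solution \<open>x\<close>
  becomes, if the specialisation of the \<open>a\<^sub>i\<close> is injective, a pair of polynomials \<open>(w\<^sub>1, w\<^sub>2) \<noteq> 0\<close>, with \<open>w\<^sub>1\<close> fixed by \<open>T\<^sub>2\<close> and \<open>w\<^sub>2\<close> by \<open>T\<^sub>1\<close>, and
  \<open>tr(x\<^sup>m)\<close> becomes the sum of the \<open>T\<^sub>1\<close>-orbit of \<open>w\<^sub>1\<^sup>m\<close> and the \<open>T\<^sub>2\<close>-orbit of \<open>w\<^sub>2\<^sup>m\<close>.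

  If \<open>sqf(n\<^sub>i)\<close> divides \<open>m\<close>, then \<open>T\<^sub>i\<close> fixes the leading monomial of \<open>w\<^sub>i\<^sup>m\<close>, which therefore
  survives in the orbit sum with the factor \<open>n\<^sub>i \<noteq> 0\<close>. By (ii) the leading monomials of \<open>w\<^sub>1\<close> and
  \<open>w\<^sub>2\<close> then coincide, so that this monomial is fixed by both groups, and the leading coefficients
  satisfy \<open>n\<^sub>1c\<^sub>1\<^sup>m + n\<^sub>2c\<^sub>2\<^sup>m = 0\<close> for \<open>m = m\<^sub>1\<close> and \<open>m = m\<^sub>2\<close>. For these
  \<open>m\<close>, \<open>u = c\<^sub>1/c\<^sub>2\<close> and \<open>q = -n\<^sub>2/n\<^sub>1\<close> satisfy \<open>u\<^sup>m = q\<close>; raising the two equations to the powers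
  \<open>m\<^sub>2\<close> and \<open>m\<^sub>1\<close> shows that \<open>q\<close> has equal \<open>m\<^sub>1\<close>-th and \<open>m\<^sub>2\<close>-th powers, against (i).
\<close>

section \<open>Homomorphisms of commutative rings\<close>

locale ring_morphism =
  fixes h :: "'a::comm_ring_1 \<Rightarrow> 'b::comm_ring_1"
  assumes one [simp]: "h 1 = 1"
    and add [simp]: "h (x + y) = h x + h y"
    and mult [simp]: "h (x * y) = h x * h y"
begin

lemma zero [simp]: "h 0 = 0"
  using add[of 0 0] by simp

lemma uminus [simp]: "h (- x) = - h x"
  using add[of x "- x"] by (simp add: eq_neg_iff_add_eq_0 add.commute)

lemma sum: "h (\<Sum>i\<in>A. f i) = (\<Sum>i\<in>A. h (f i))"
  by (induction A rule: infinite_finite_induct) simp_all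

lemma prod: "h (\<Prod>i\<in>A. f i) = (\<Prod>i\<in>A. h (f i))"
  by (induction A rule: infinite_finite_induct) simp_all

lemma power [simp]: "h (x ^ m) = h x ^ m"
  by (induction m) simp_all

lemma of_nat [simp]: "h (of_nat m) = of_nat m"
  by (induction m) simp_all

lemma map_poly_pCons [simp]: "map_poly h (pCons a p) = pCons (h a) (map_poly h p)"
  by (simp add: map_poly_pCons)

lemma coeff_map_poly [simp]: "coeff (map_poly h p) i = h (coeff p i)"
  by (simp add: coeff_map_poly)

lemma map_poly_add: "map_poly h (p + q) = map_poly h p + map_poly h q"
  by (rule poly_eqI) simp

lemma map_poly_smult: "map_poly h (smult c p) = smult (h c) (map_poly h p)"
  by (rule poly_eqI) simp

lemma map_poly_monom: "map_poly h (monom c j) = monom (h c) j"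
  by (rule poly_eqI) simp

lemma map_poly_mult: "map_poly h (p * q) = map_poly h p * map_poly h q"
  by (rule poly_eqI) (simp add: coeff_mult sum)

lemma map_poly_one: "map_poly h 1 = 1"
  by (simp add: one_pCons)

lemma map_poly_prod: "map_poly h (\<Prod>i\<in>A. f i) = (\<Prod>i\<in>A. map_poly h (f i))"
  by (induction A rule: infinite_finite_induct) (simp_all add: map_poly_one map_poly_mult)

lemma map_poly_power: "map_poly h (p ^ m) = map_poly h p ^ m"
  by (induction m) (simp_all add: map_poly_one map_poly_mult)

lemma poly_map_poly: "poly (map_poly h p) (h x) = h (poly p x)"
  by (induction p) simp_all

lemma map_poly_prod_linear:
  "map_poly h (\<Prod>i\<in>A. [:- c i, 1:]) = (\<Prod>i\<in>A. [:- h (c i), 1:])"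
  by (simp add: map_poly_prod)

end

lemma ring_morphism_to_ac: "ring_morphism to_ac"
  by standard simp_all

lemma ring_morphism_comp:
  assumes "ring_morphism f" "ring_morphism g"
  shows "ring_morphism (\<lambda>x. f (g x))"
proof -
  interpret f: ring_morphism f by fact
  interpret g: ring_morphism g by fact
  show ?thesis by standard simp_all
qed


section \<open>Evaluation of polynomials in several variables\<close>

definition monomial_eval :: "('v \<Rightarrow> 's::comm_ring_1) \<Rightarrow> ('v \<Rightarrow>\<^sub>0 nat) \<Rightarrow> 's" where
  "monomial_eval c \<gamma> = (\<Prod>l\<in>Poly_Mapping.keys \<gamma>. c l ^ Poly_Mapping.lookup \<gamma> l)"

text \<open>The evaluation homomorphism. The map \<open>h\<close> acts on the coefficients, so that
  evaluation at a point, scaling of the variables and specialisation of the indeterminates of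
  \<open>gen_poly\<close> are all instances.\<close>

definition subst ::
  "('k::comm_ring_1 \<Rightarrow> 's::comm_ring_1) \<Rightarrow> ('v \<Rightarrow> 's) \<Rightarrow> (('v \<Rightarrow>\<^sub>0 nat) \<Rightarrow>\<^sub>0 'k) \<Rightarrow> 's" where
  "subst h c q =
    (\<Sum>\<gamma>\<in>Poly_Mapping.keys q. h (Poly_Mapping.lookup q \<gamma>) * monomial_eval c \<gamma>)"

abbreviation pm_const :: "'k::zero \<Rightarrow> ('v \<Rightarrow>\<^sub>0 nat) \<Rightarrow>\<^sub>0 'k" where
  "pm_const \<equiv> Poly_Mapping.single 0"

abbreviation pm_var :: "'v \<Rightarrow> ('v \<Rightarrow>\<^sub>0 nat) \<Rightarrow>\<^sub>0 'k::zero_neq_one" where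
  "pm_var l \<equiv> Poly_Mapping.single (Poly_Mapping.single l 1) 1"

lemma monomial_eval_superset:
  assumes "finite A" "Poly_Mapping.keys \<gamma> \<subseteq> A"
  shows "monomial_eval c \<gamma> = (\<Prod>l\<in>A. c l ^ Poly_Mapping.lookup \<gamma> l)"
  unfolding monomial_eval_def
  using assms by (intro prod.mono_neutral_left) (auto simp: in_keys_iff)

lemma monomial_eval_0 [simp]: "monomial_eval c 0 = 1"
  by (simp add: monomial_eval_def)

lemma monomial_eval_single [simp]: "monomial_eval c (Poly_Mapping.single l m) = c l ^ m"
  by (simp add: monomial_eval_def)

lemma monomial_eval_add: "monomial_eval c (\<gamma> + \<delta>) = monomial_eval c \<gamma> * monomial_eval c \<delta>"
proof -
  let ?A = "Poly_Mapping.keys \<gamma> \<union> Poly_Mapping.keys \<delta>"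
  have "monomial_eval c (\<gamma> + \<delta>) = (\<Prod>l\<in>?A. c l ^ Poly_Mapping.lookup (\<gamma> + \<delta>) l)"
    using keys_add[of \<gamma> \<delta>] by (intro monomial_eval_superset) auto
  also have "\<dots> = (\<Prod>l\<in>?A. c l ^ Poly_Mapping.lookup \<gamma> l) * (\<Prod>l\<in>?A. c l ^ Poly_Mapping.lookup \<delta> l)"
    by (simp add: lookup_add power_add prod.distrib)
  also have "\<dots> = monomial_eval c \<gamma> * monomial_eval c \<delta>"
    by (intro arg_cong2[where f = "(*)"] monomial_eval_superset[symmetric]) auto
  finally show ?thesis .
qed

lemma monomial_eval_mult:
  "monomial_eval (\<lambda>l. c l * d l) \<gamma> = monomial_eval c \<gamma> * monomial_eval d \<gamma>"
  by (simp add: monomial_eval_def power_mult_distrib prod.distrib)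

lemma (in ring_morphism) monomial_eval: "h (monomial_eval c \<gamma>) = monomial_eval (\<lambda>l. h (c l)) \<gamma>"
  by (simp add: monomial_eval_def prod)

lemma pm_sum_single:
  "q = (\<Sum>\<gamma>\<in>Poly_Mapping.keys q. Poly_Mapping.single \<gamma> (Poly_Mapping.lookup q \<gamma>))"
  by (rule poly_mapping_eqI)
     (auto simp: lookup_sum lookup_single when_def in_keys_iff sum.delta)

context ring_morphism
begin

lemma subst_superset:
  assumes "finite A" "Poly_Mapping.keys q \<subseteq> A"
  shows "subst h c q = (\<Sum>\<gamma>\<in>A. h (Poly_Mapping.lookup q \<gamma>) * monomial_eval c \<gamma>)"
  unfolding subst_def
  using assms by (intro sum.mono_neutral_left) (auto simp: in_keys_iff)

lemma subst_single [simp]: "subst h c (Poly_Mapping.single \<gamma> a) = h a * monomial_eval c \<gamma>"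
  by (simp add: subst_def)

lemma subst_0 [simp]: "subst h c 0 = 0"
  by (simp add: subst_def)

lemma subst_add: "subst h c (p + q) = subst h c p + subst h c q"
proof -
  let ?A = "Poly_Mapping.keys p \<union> Poly_Mapping.keys q"
  have "subst h c (p + q) = (\<Sum>\<gamma>\<in>?A. h (Poly_Mapping.lookup (p + q) \<gamma>) * monomial_eval c \<gamma>)"
    using keys_add[of p q] by (intro subst_superset) auto
  also have "\<dots> = (\<Sum>\<gamma>\<in>?A. h (Poly_Mapping.lookup p \<gamma>) * monomial_eval c \<gamma>)
      + (\<Sum>\<gamma>\<in>?A. h (Poly_Mapping.lookup q \<gamma>) * monomial_eval c \<gamma>)"
    by (simp add: lookup_add distrib_right sum.distrib)
  also have "\<dots> = subst h c p + subst h c q"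
    by (intro arg_cong2[where f = "(+)"] subst_superset[symmetric]) auto
  finally show ?thesis .
qed

lemma subst_sum: "subst h c (\<Sum>i\<in>A. f i) = (\<Sum>i\<in>A. subst h c (f i))"
  by (induction A rule: infinite_finite_induct) (simp_all add: subst_add)

lemma subst_mult: "subst h c (p * q) = subst h c p * subst h c q"
proof -
  let ?s = "\<lambda>p \<gamma>. Poly_Mapping.single \<gamma> (Poly_Mapping.lookup p \<gamma>)"
  have "p * q = (\<Sum>\<gamma>\<in>Poly_Mapping.keys p. ?s p \<gamma>) * (\<Sum>\<delta>\<in>Poly_Mapping.keys q. ?s q \<delta>)"
    by (simp only: pm_sum_single[symmetric])
  also have "\<dots> = (\<Sum>\<gamma>\<in>Poly_Mapping.keys p. \<Sum>\<delta>\<in>Poly_Mapping.keys q. ?s p \<gamma> * ?s q \<delta>)"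
    by (rule sum_product)
  finally have "subst h c (p * q)
      = (\<Sum>\<gamma>\<in>Poly_Mapping.keys p. \<Sum>\<delta>\<in>Poly_Mapping.keys q. subst h c (?s p \<gamma> * ?s q \<delta>))"
    by (simp only: subst_sum)
  also have "\<dots> = subst h c p * subst h c q"
    by (simp add: subst_def[of h c p] subst_def[of h c q] sum_product mult_single
        monomial_eval_add algebra_simps)
  finally show ?thesis .
qed

lemma ring_morphism_subst: "ring_morphism (subst h c)"
  by standard (simp_all add: subst_add subst_mult flip: single_one)

lemma subst_var [simp]: "subst h c (pm_var l) = c l"
  by simp

end

lemma (in ring_morphism) comp_subst: "h (subst g c q) = subst (\<lambda>a. h (g a)) (\<lambda>l. h (c l)) q"
  by (simp add: subst_def sum monomial_eval)

lemma ring_morphism_id: "ring_morphism (\<lambda>x. x)"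
  by standard simp_all

lemma ring_morphism_pm_const: "ring_morphism pm_const"
  by standard (simp_all add: single_add mult_single)

lemma monomial_eval_pm_var:
  "monomial_eval pm_var \<gamma> = Poly_Mapping.single \<gamma> (1 :: 'k::comm_ring_1)"
proof -
  have pw: "pm_var l ^ m = Poly_Mapping.single (Poly_Mapping.single l m) (1 :: 'k)" for l :: 'v and m
    by (induction m) (simp_all add: mult_single flip: single_add)
  have prod: "(\<Prod>l\<in>A. Poly_Mapping.single (f l) 1) = Poly_Mapping.single (\<Sum>l\<in>A. f l) (1 :: 'k)"
    for f :: "'v \<Rightarrow> 'v \<Rightarrow>\<^sub>0 nat" and A
    by (induction A rule: infinite_finite_induct) (simp_all add: mult_single)
  show ?thesis
    unfolding monomial_eval_def pw prod by (simp only: pm_sum_single[symmetric])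
qed

lemma subst_pm_var: "subst pm_const pm_var q = q"
proof -
  have "subst pm_const pm_var q
      = (\<Sum>\<gamma>\<in>Poly_Mapping.keys q. Poly_Mapping.single \<gamma> (Poly_Mapping.lookup q \<gamma>))"
    unfolding subst_def monomial_eval_pm_var by (simp add: mult_single)
  then show ?thesis
    by (simp only: pm_sum_single[symmetric])
qed

text \<open>Monomials are eigenvectors of these scalings. Identities between scalings can therefore
  be checked one coefficient at a time, and over a field a polynomial fixed by a scaling contains
  only monomials of eigenvalue 1.\<close>

lemma lookup_subst_scale:
  fixes w :: "('v \<Rightarrow>\<^sub>0 nat) \<Rightarrow>\<^sub>0 'k::comm_ring_1"
  shows "Poly_Mapping.lookup (subst pm_const (\<lambda>l. pm_const (\<tau> l) * pm_var l) w) \<gamma>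
    = Poly_Mapping.lookup w \<gamma> * monomial_eval \<tau> \<gamma>"
proof -
  interpret c: ring_morphism "pm_const :: 'k \<Rightarrow> ('v \<Rightarrow>\<^sub>0 nat) \<Rightarrow>\<^sub>0 'k"
    by (rule ring_morphism_pm_const)
  have "monomial_eval (\<lambda>l. pm_const (\<tau> l) * pm_var l) \<delta>
      = Poly_Mapping.single \<delta> (monomial_eval \<tau> \<delta>)" for \<delta>
    by (simp only: monomial_eval_mult c.monomial_eval[symmetric] monomial_eval_pm_var)
       (simp add: mult_single)
  then show ?thesis
    by (auto simp: subst_def mult_single lookup_sum lookup_single when_def in_keys_iff sum.delta)
qed


section \<open>Traces as sums over roots\<close>

lemma ring_morphism_Fract: "ring_morphism (\<lambda>a. Fract a 1)"
  by standard (simp_all add: One_fract_def)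

lemma Fract_eq_0_iff: "Fract a 1 = 0 \<longleftrightarrow> a = 0"
  by (simp add: Zero_fract_def eq_fract)

text \<open>Injectivity keeps denominators nonzero, and cross-multiplication then shows that
  \<open>f a / f b\<close> depends only on the fraction \<open>Fract a b\<close>.\<close>

lemma ring_morphism_fract_extension:
  fixes f :: "'a::idom \<Rightarrow> 'b::field"
  assumes "ring_morphism f" and inj: "\<And>x. f x = 0 \<Longrightarrow> x = 0"
  obtains g :: "'a fract \<Rightarrow> 'b"
    where "ring_morphism g" "\<And>a b. b \<noteq> 0 \<Longrightarrow> g (Fract a b) = f a / f b"
proof -
  interpret f: ring_morphism f by fact
  define g where "g q = (SOME v. \<exists>a b. b \<noteq> 0 \<and> q = Fract a b \<and> v = f a / f b)" for q
  have g: "g (Fract a b) = f a / f b" if "b \<noteq> 0" for a b :: 'a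
  proof -
    have "\<exists>v a' b'. b' \<noteq> 0 \<and> Fract a b = Fract a' b' \<and> v = f a' / f b'"
      using that by blast
    then have "\<exists>a' b'. b' \<noteq> 0 \<and> Fract a b = Fract a' b' \<and> g (Fract a b) = f a' / f b'"
      unfolding g_def by (rule someI_ex)
    then obtain a' b' where b': "b' \<noteq> 0" "Fract a b = Fract a' b'" "g (Fract a b) = f a' / f b'"
      by blast
    then have "a * b' = a' * b"
      using that by (simp add: eq_fract)
    then have "f a * f b' = f a' * f b"
      by (metis f.mult)
    then show ?thesis
      using b' that inj[of b] inj[of b'] by (metis frac_eq_eq)
  qed
  have "ring_morphism g"
  proof
    show "g 1 = 1"
      by (simp add: One_fract_def g)
    fix x y :: "'a fract"
    obtain a b c d where xy: "x = Fract a b" "b \<noteq> 0" "y = Fract c d" "d \<noteq> 0"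
      by (metis Fract_cases)
    have "f b \<noteq> 0" "f d \<noteq> 0"
      using xy inj by auto
    then show "g (x + y) = g x + g y" "g (x * y) = g x * g y"
      using xy by (simp_all add: g divide_simps)
  qed
  with g show ?thesis
    by (intro that)
qed

lemma prod_linear_monic:
  fixes c :: "'i \<Rightarrow> 'a::idom"
  assumes "finite I"
  shows "degree (\<Prod>i\<in>I. [:- c i, 1:]) = card I" "lead_coeff (\<Prod>i\<in>I. [:- c i, 1:]) = 1"
proof -
  have "degree (\<Prod>i\<in>I. [:- c i, 1:]) = (\<Sum>i\<in>I. degree [:- c i, 1:])"
    by (rule degree_prod_eq_sum_degree) simp
  then show "degree (\<Prod>i\<in>I. [:- c i, 1:]) = card I"
    by simp
  show "lead_coeff (\<Prod>i\<in>I. [:- c i, 1:]) = 1"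
    by (simp add: lead_coeff_prod)
qed

lemma poly_eq_0_if_card_roots:
  fixes p :: "'a::idom poly"
  assumes "finite I" "inj_on b I" "degree p < card I" "\<And>i. i \<in> I \<Longrightarrow> poly p (b i) = 0"
  shows "p = 0"
proof (rule ccontr)
  assume p: "p \<noteq> 0"
  have "card I = card (b ` I)"
    using assms by (simp add: card_image)
  also have "\<dots> \<le> card {x. poly p x = 0}"
    using assms p by (intro card_mono poly_roots_finite) auto
  also have "\<dots> \<le> degree p"
    using p by (rule card_poly_roots_bound)
  finally show False
    using assms by simp
qed

text \<open>Each \<open>l i\<close> is the product of the \<open>X - b j\<close> over
  \<open>j \<noteq> i\<close>, divided by its value at \<open>b i\<close>, which is nonzero because
  \<open>b\<close> is injective on \<open>I\<close>.\<close>

lemma lagrange_basis: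
  fixes b :: "'i \<Rightarrow> 'a::field"
  assumes "finite I" "inj_on b I"
  obtains l where "\<And>i. i \<in> I \<Longrightarrow> degree (l i) < card I"
    "\<And>i j. i \<in> I \<Longrightarrow> j \<in> I \<Longrightarrow> poly (l i) (b j) = (if i = j then 1 else 0)"
proof
  define L where "L i = (\<Prod>j\<in>I - {i}. [:- b j, 1:])" for i
  define l where "l i = smult (inverse (poly (L i) (b i))) (L i)" for i
  fix i assume i: "i \<in> I"
  have "degree (l i) \<le> card (I - {i})"
    unfolding l_def L_def using assms(1) by (metis degree_smult_le finite_Diff prod_linear_monic(1))
  also have "\<dots> < card I"
    using assms(1) i by (rule card_Diff1_less)
  finally show "degree (l i) < card I" .
  fix j assume j: "j \<in> I"
  have "poly (L i) (b i) \<noteq> 0"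
    using assms i by (auto simp: L_def poly_prod inj_on_def)
  moreover have "poly (L i) (b j) = 0" if "i \<noteq> j"
    using assms j that by (auto simp: L_def poly_prod)
  ultimately show "poly (l i) (b j) = (if i = j then 1 else 0)"
    by (cases "i = j") (simp_all add: l_def)
qed

lemma poly_eq_sum_lessThan:
  fixes x :: "'a::comm_ring_1"
  assumes "degree p < n"
  shows "poly p x = (\<Sum>j<n. coeff p j * x ^ j)"
  unfolding poly_altdef using assms by (intro sum.mono_neutral_left) (auto simp: coeff_eq_0)

lemma representation_gen_power_basis:
  fixes q :: "('k::field, 'n::finite) gen_base poly"
  assumes "degree q < CARD('n)" "j < CARD('n)"
  shows "gen_ext.representation gen_power_basis (gen_class q) (gen_class (monom 1 j)) = coeff q j"
proof -
  let ?B = "gen_power_basis :: ('k, 'n) gen_ext set"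
  let ?b = "\<lambda>i. gen_class (monom 1 i) :: ('k, 'n) gen_ext"
  have mem: "?b i \<in> ?B" if "i < CARD('n)" for i
    using that by (auto simp: gen_power_basis_def)
  have "q = (\<Sum>i<CARD('n). monom (coeff q i) i)"
    using assms by (intro poly_eqI) (auto simp: coeff_sum coeff_eq_0)
  then have "gen_class q = (\<Sum>i<CARD('n). gen_scale (coeff q i) (?b i))"
    by (metis (no_types, lifting) gen_class_sum gen_scale_class smult_monom mult.right_neutral sum.cong)
  then have "gen_ext.representation ?B (gen_class q) (?b j)
      = (\<Sum>i<CARD('n). coeff q i * gen_ext.representation ?B (?b i) (?b j))"
    by (simp add: gen_ext.representation_sum gen_ext.representation_scale independent_gen_power_basis
        span_gen_power_basis)
  also have "\<dots> = (\<Sum>i<CARD('n). if i = j then coeff q i else 0)"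
    using assms(2) inj_on_gen_class_monom[where 'k = 'k and 'n = 'n]
    by (intro sum.cong refl)
       (auto simp: gen_ext.representation_basis[OF independent_gen_power_basis mem] inj_on_def)
  also have "\<dots> = coeff q j"
    using assms(2) by simp
  finally show ?thesis .
qed

text \<open>In the basis of powers of \<open>X\<close>, the \<open>j\<close>-th column of the matrix
  of multiplication by \<open>p\<close> is the remainder of \<open>p * monom 1 j\<close> modulo
  \<open>gen_poly\<close>.\<close>

lemma gen_trace_class:
  fixes p :: "('k::field, 'n::finite) gen_base poly"
  shows "gen_trace (gen_class p) = (\<Sum>j<CARD('n). coeff ((p * monom 1 j) mod gen_poly) j)"
proof -
  have "gen_trace (gen_class p) = (\<Sum>j<CARD('n).
      gen_ext.representation gen_power_basis (gen_class p * gen_class (monom 1 j)) (gen_class (monom 1 j)))"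
    unfolding gen_trace_eq[OF finite_gen_power_basis independent_gen_power_basis span_gen_power_basis]
    unfolding gen_power_basis_def by (simp add: sum.reindex[OF inj_on_gen_class_monom])
  also have "\<dots> = (\<Sum>j<CARD('n). coeff ((p * monom 1 j) mod gen_poly) j)"
  proof (intro sum.cong refl)
    fix j assume j: "j \<in> {..<CARD('n)}"
    let ?q = "(p * monom 1 j) mod (gen_poly :: ('k, 'n) gen_base poly)"
    have "gen_class p * gen_class (monom 1 j) = gen_class ?q"
      unfolding times_gen_ext.abs_eq gen_ext.abs_eq_iff by (simp add: minus_mod_eq_mult_div)
    moreover have "degree ?q < CARD('n)"
      using degree_mod_less[OF gen_poly_nonzero, of "p * monom 1 j"] by (auto simp: degree_gen_poly)
    ultimately show "gen_ext.representation gen_power_basis (gen_class p * gen_class (monom 1 j))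
        (gen_class (monom 1 j)) = coeff ?q j"
      using j representation_gen_power_basis by simp
  qed
  finally show ?thesis .
qed

text \<open>In the Lagrange basis of \<open>F[X]/(\<Prod>(X - \<beta>\<^sub>i))\<close>, multiplication by \<open>p\<close> is diagonal with entries
  \<open>p(\<beta>\<^sub>i)\<close>. The computation below is the change between this basis and the powers of \<open>X\<close>.\<close>

lemma gen_trace_eq_sum_roots:
  fixes h :: "('k::field, 'n::finite) gen_base \<Rightarrow> 'f::field" and \<beta> :: "'i \<Rightarrow> 'f"
  assumes "ring_morphism h" "finite I" "inj_on \<beta> I"
    and split: "map_poly h gen_poly = (\<Prod>i\<in>I. [:- \<beta> i, 1:])"
  shows "h (gen_trace (gen_class p)) = (\<Sum>i\<in>I. poly (map_poly h p) (\<beta> i))"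
proof -
  interpret h: ring_morphism h by fact
  define g where "g j = (p * monom 1 j) mod gen_poly" for j
  define G where "G j = map_poly h (g j)" for j
  have "degree (map_poly h gen_poly) = CARD('n)"
  proof (rule antisym)
    show "degree (map_poly h gen_poly) \<le> CARD('n)"
      by (metis degree_gen_poly map_poly_degree_leq)
    have "h (coeff gen_poly CARD('n)) \<noteq> 0"
      using degree_gen_poly_tail[where 'k = 'k and 'n = 'n]
      by (simp add: gen_poly_def coeff_eq_0)
    then show "CARD('n) \<le> degree (map_poly h gen_poly)"
      by (intro le_degree) simp
  qed
  then have card: "card I = CARD('n)"
    using assms(2) split by (simp add: prod_linear_monic)
  obtain l where deg: "\<And>i. i \<in> I \<Longrightarrow> degree (l i) < card I"
    and l: "\<And>i j. i \<in> I \<Longrightarrow> j \<in> I \<Longrightarrow> poly (l i) (\<beta> j) = (if i = j then 1 else 0)"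
    using lagrange_basis[OF assms(2,3)] by blast
  have G_root: "poly (G j) (\<beta> i) = poly (map_poly h p) (\<beta> i) * \<beta> i ^ j" if "i \<in> I" for i j
  proof -
    have "g j = p * monom 1 j + - (p * monom 1 j div gen_poly) * gen_poly"
      by (simp add: g_def minus_div_mult_eq_mod)
    then have "G j = map_poly h p * monom 1 j + map_poly h (- (p * monom 1 j div gen_poly)) * map_poly h gen_poly"
      by (simp only: G_def h.map_poly_add h.map_poly_mult h.map_poly_monom h.one)
    moreover have "poly (map_poly h gen_poly) (\<beta> i) = 0"
      using that assms(2) by (auto simp: split poly_prod)
    ultimately show ?thesis
      by (simp add: poly_monom)
  qed
  \<comment> \<open>Both sides have degree below \<open>card I\<close> and agree at the
    \<open>card I\<close> distinct points \<open>\<beta> i\<close>.\<close>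
  have G: "G j = (\<Sum>i\<in>I. smult (poly (map_poly h p) (\<beta> i) * \<beta> i ^ j) (l i))" for j
  proof -
    let ?S = "\<Sum>i\<in>I. smult (poly (map_poly h p) (\<beta> i) * \<beta> i ^ j) (l i)"
    have "G j - ?S = 0"
    proof (rule poly_eq_0_if_card_roots[OF assms(2,3)])
      have "degree (g j) < CARD('n)"
        using degree_mod_less[OF gen_poly_nonzero, of "p * monom 1 j"] by (auto simp: g_def degree_gen_poly)
      then have "degree (G j) < card I"
        unfolding G_def card using map_poly_degree_leq le_less_trans by blast
      moreover have "degree ?S < card I"
        using deg card zero_less_card_finite[where 'a = 'n]
        by (intro degree_sum_less) (auto intro: le_less_trans[OF degree_smult_le])
      ultimately show "degree (G j - ?S) < card I"
        by (rule degree_diff_less)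
      fix i assume "i \<in> I"
      then show "poly (G j - ?S) (\<beta> i) = 0"
        using assms(2) by (simp add: G_root poly_sum l if_distrib[of "(*) _"] cong: if_cong)
    qed
    then show ?thesis by simp
  qed
  have "h (gen_trace (gen_class p)) = (\<Sum>j<card I. coeff (G j) j)"
    unfolding gen_trace_class h.sum by (simp add: G_def g_def card)
  also have "\<dots> = (\<Sum>j<card I. \<Sum>i\<in>I. poly (map_poly h p) (\<beta> i) * (coeff (l i) j * \<beta> i ^ j))"
    unfolding G by (simp add: coeff_sum algebra_simps)
  \<comment> \<open>For fixed \<open>i\<close>, the sum of
    \<open>coeff (l i) j * \<beta> i ^ j\<close> over \<open>j\<close> is the value of
    \<open>l i\<close> at \<open>\<beta> i\<close>, which is 1.\<close>
  also have "\<dots> = (\<Sum>i\<in>I. \<Sum>j<card I. poly (map_poly h p) (\<beta> i) * (coeff (l i) j * \<beta> i ^ j))"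
    by (rule sum.swap)
  also have "\<dots> = (\<Sum>i\<in>I. poly (map_poly h p) (\<beta> i) * poly (l i) (\<beta> i))"
    by (intro sum.cong refl) (simp only: poly_eq_sum_lessThan[OF deg] sum_distrib_left)
  also have "\<dots> = (\<Sum>i\<in>I. poly (map_poly h p) (\<beta> i))"
    by (simp add: l)
  finally show ?thesis .
qed


section \<open>Independence of the elementary symmetric polynomials\<close>

lemma alg_closed_splits:
  fixes p :: "'a::alg_closed_field poly"
  assumes "lead_coeff p = 1"
  obtains xs where "length xs = degree p" "p = (\<Prod>x\<leftarrow>xs. [:- x, 1:])"
proof -
  obtain A where A: "size A = degree p" "p = smult (lead_coeff p) (\<Prod>x\<in>#A. [:- x, 1:])"
    using alg_closed_imp_factorization[of p] assms by force
  obtain xs where "mset xs = A"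
    using ex_mset by blast
  with A assms have "length xs = degree p" "p = (\<Prod>x\<leftarrow>xs. [:- x, 1:])"
    by (auto simp flip: prod_mset_prod_list)
  then show ?thesis
    by (rule that)
qed

lemma
  shows finite_var_index: "finite (UNIV :: 'n::finite var_index set)"
    and card_var_index: "card (UNIV :: 'n::finite var_index set) = CARD('n)"
proof -
  interpret type_definition "nat_of_index :: 'n var_index \<Rightarrow> nat" index_of_nat "{1..CARD('n)}"
    by (rule type_definition_var_index)
  show "card (UNIV :: 'n::finite var_index set) = CARD('n)"
    by (simp add: card)
  show "finite (UNIV :: 'n::finite var_index set)"
    using Abs_image by (metis finite_atLeastAtMost finite_imageI)
qed

text \<open>The roots are indexed by the type of the indeterminates, so that they can be substituted
  for the variables.\<close>

lemma alg_closed_splits_var_index: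
  fixes p :: "'a::alg_closed_field poly"
  assumes "lead_coeff p = 1" "degree p = CARD('n::finite)"
  obtains \<rho> :: "'n::finite var_index \<Rightarrow> 'a" where "p = (\<Prod>l\<in>UNIV. [:- \<rho> l, 1:])"
proof -
  obtain xs where xs: "length xs = degree p" "p = (\<Prod>x\<leftarrow>xs. [:- x, 1:])"
    using alg_closed_splits[OF assms(1)] .
  obtain e :: "'n var_index \<Rightarrow> nat" where e: "bij_betw e UNIV {..<CARD('n)}"
    using ex_bij_betw_finite_nat[OF finite_var_index] by (auto simp: card_var_index atLeast0LessThan)
  have "p = (\<Prod>i<length xs. [:- (xs ! i), 1:])"
    unfolding xs(2) by (simp add: prod.list_conv_set_nth atLeast0LessThan)
  also have "\<dots> = (\<Prod>l\<in>UNIV. [:- (xs ! e l), 1:])"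
    using prod.reindex_bij_betw[OF e, of "\<lambda>i. [:- (xs ! i), 1:]"] xs(1) assms(2) by simp
  finally show ?thesis
    by (rule that)
qed

lemma gen_coeff_nat_of_index: "gen_coeff (nat_of_index l) = Fract (pm_var l) 1"
  by (simp add: gen_coeff_def nat_of_index_inverse)

lemma coeff_gen_poly:
  fixes l :: "'n::finite var_index"
  shows "coeff (gen_poly :: ('k::field, 'n) gen_base poly) (CARD('n) - nat_of_index l) = Fract (pm_var l) 1"
proof -
  have l: "1 \<le> nat_of_index l" "nat_of_index l \<le> CARD('n)"
    using nat_of_index[of l] by auto
  then have "coeff (gen_poly :: ('k, 'n) gen_base poly) (CARD('n) - nat_of_index l)
      = (\<Sum>i = 1..CARD('n). if i = nat_of_index l then gen_coeff i else 0)"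
    unfolding gen_poly_def coeff_add coeff_sum coeff_monom
    by (subst if_not_P, simp, simp only: add_0_left, intro sum.cong refl, auto)
  also have "\<dots> = gen_coeff (nat_of_index l)"
    using l by (simp add: sum.delta)
  finally show ?thesis
    by (simp only: gen_coeff_nat_of_index)
qed

lemma lead_coeff_gen_poly: "lead_coeff (gen_poly :: ('k::field, 'n::finite) gen_base poly) = 1"
  using degree_gen_poly_tail[where 'k = 'k and 'n = 'n]
  by (simp add: degree_gen_poly) (simp add: gen_poly_def coeff_eq_0)

text \<open>Both polynomials are monic of the same degree, and the remaining coefficients of
  \<open>gen_poly\<close> are exactly the indeterminates, so their images under \<open>h\<close>
  decide.\<close>

lemma map_gen_poly_eqI:
  fixes h :: "('k::field, 'n::finite) gen_base \<Rightarrow> 's::comm_ring_1"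
  assumes "ring_morphism h" "degree f = CARD('n)" "lead_coeff f = 1"
    and coeff: "\<And>l. h (Fract (pm_var l) 1) = coeff f (CARD('n) - nat_of_index l)"
  shows "map_poly h gen_poly = f"
proof (rule poly_eqI)
  interpret h: ring_morphism h by fact
  fix j
  consider "j > CARD('n)" | "j = CARD('n)" | "j < CARD('n)"
    by linarith
  then show "coeff (map_poly h gen_poly) j = coeff f j"
  proof cases
    case 1
    then show ?thesis
      using assms(2) by (simp add: coeff_eq_0 degree_gen_poly)
  next
    case 2
    then show ?thesis
      using assms(2,3) lead_coeff_gen_poly[where 'k = 'k and 'n = 'n] by (simp add: degree_gen_poly)
  next
    case 3
    define l :: "'n var_index" where "l = index_of_nat (CARD('n) - j)"
    have "nat_of_index l = CARD('n) - j"
      unfolding l_def using 3 by (intro index_of_nat_inverse) auto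
    then have "j = CARD('n) - nat_of_index l"
      using 3 by simp
    then show ?thesis
      by (simp only: h.coeff_map_poly coeff_gen_poly coeff)
  qed
qed

text \<open>Composing \<open>a\<^sub>i \<mapsto> \<plusminus>e\<^sub>i(r)\<close> with the substitution of the roots of \<open>gen_poly\<close> for the \<open>r\<^sub>l\<close>
  gives back the identity.\<close>

lemma subst_elementary_symmetric_eq_0:
  fixes q :: "('k::field, 'n::finite) gen_mpoly"
  defines "i \<equiv> \<lambda>q :: ('k, 'n) gen_mpoly. to_ac (Fract q 1)"
  defines "f \<equiv> \<Prod>l\<in>UNIV. [:- i (pm_var l), 1:]"
  assumes "subst (\<lambda>a. i (pm_const a)) (\<lambda>l. coeff f (CARD('n) - nat_of_index l)) q = 0"
  shows "q = 0"
proof -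
  interpret i: ring_morphism i
    unfolding i_def by (rule ring_morphism_comp[OF ring_morphism_to_ac ring_morphism_Fract])
  interpret c: ring_morphism "pm_const :: 'k \<Rightarrow> ('k, 'n) gen_mpoly"
    by (rule ring_morphism_pm_const)
  interpret ic: ring_morphism "\<lambda>a :: 'k. i (pm_const a)"
    by (rule ring_morphism_comp) unfold_locales
  interpret ac: ring_morphism "to_ac :: ('k, 'n) gen_base \<Rightarrow> _"
    by (rule ring_morphism_to_ac)
  have i_eq_0: "i p = 0 \<longleftrightarrow> p = 0" for p
    by (simp add: i_def Fract_eq_0_iff)
  \<comment> \<open>The variables play a second role here, as formal roots: \<open>f0\<close> is the
    polynomial with these roots before the embedding \<open>i\<close>, and \<open>\<psi>\<close>
    sends each indeterminate to the corresponding coefficient of \<open>f0\<close>.\<close>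
  define f0 where "f0 = (\<Prod>l\<in>UNIV. [:- pm_var l :: ('k, 'n) gen_mpoly, 1:])"
  define \<psi> :: "('k, 'n) gen_mpoly \<Rightarrow> ('k, 'n) gen_mpoly" where "\<psi> = subst pm_const (\<lambda>l. coeff f0 (CARD('n) - nat_of_index l))"
  have "map_poly i f0 = f"
    unfolding f0_def f_def by (rule i.map_poly_prod_linear)
  then have f: "coeff f j = i (coeff f0 j)" for j
    by (metis i.coeff_map_poly)
  have "i (\<psi> q) = 0"
    using assms(3) unfolding \<psi>_def i.comp_subst f .
  then have \<psi>0: "\<psi> q = 0"
    by (simp add: i_eq_0)
  have deg: "degree (map_poly to_ac (gen_poly :: ('k, 'n) gen_base poly)) = CARD('n)"
    by (simp add: degree_map_poly degree_gen_poly)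
  then have "lead_coeff (map_poly to_ac (gen_poly :: ('k, 'n) gen_base poly)) = 1"
    using lead_coeff_gen_poly[where 'k = 'k and 'n = 'n] by (simp add: degree_gen_poly)
  from alg_closed_splits_var_index[OF this deg]
  obtain \<rho> :: "'n var_index \<Rightarrow> ('k, 'n) gen_base alg_closure"
    where \<rho>: "map_poly to_ac gen_poly = (\<Prod>l\<in>UNIV. [:- \<rho> l, 1:])" .
  define \<chi> where "\<chi> = subst (\<lambda>a. i (pm_const a)) \<rho>"
  interpret \<chi>: ring_morphism \<chi>
    unfolding \<chi>_def by (rule ic.ring_morphism_subst)
  have "map_poly \<chi> f0 = map_poly to_ac gen_poly"
    unfolding f0_def \<rho> \<chi>.map_poly_prod_linear by (simp add: \<chi>_def ic.subst_var del: One_nat_def)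
  then have coeff_\<chi>: "\<chi> (coeff f0 j) = to_ac (coeff gen_poly j)" for j
    by (metis \<chi>.coeff_map_poly ac.coeff_map_poly)
  have \<chi>_const: "\<chi> (pm_const a) = i (pm_const a)" for a
    unfolding \<chi>_def by (simp add: ic.subst_single)
  have "\<chi> (\<psi> q) = subst (\<lambda>a. i (pm_const a)) (\<lambda>l. i (pm_var l)) q"
    unfolding \<psi>_def \<chi>.comp_subst coeff_\<chi> coeff_gen_poly \<chi>_const by (simp only: i_def)
  also have "\<dots> = i q"
    by (simp only: i.comp_subst[symmetric] subst_pm_var)
  finally show ?thesis
    using \<psi>0 by (simp add: i_eq_0)
qed


section \<open>Diagonal automorphisms\<close>

abbreviation pm_eval :: "('v \<Rightarrow> 'k::comm_ring_1) \<Rightarrow> (('v \<Rightarrow>\<^sub>0 nat) \<Rightarrow>\<^sub>0 'k) \<Rightarrow> 'k" where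
  "pm_eval \<equiv> subst (\<lambda>x. x)"

definition pm_scale ::
  "('v \<Rightarrow> 'k::comm_ring_1) \<Rightarrow> (('v \<Rightarrow>\<^sub>0 nat) \<Rightarrow>\<^sub>0 'k) \<Rightarrow> (('v \<Rightarrow>\<^sub>0 nat) \<Rightarrow>\<^sub>0 'k)" where
  "pm_scale \<tau> = subst pm_const (\<lambda>l. pm_const (\<tau> l) * pm_var l)"

lemma lookup_pm_scale:
  "Poly_Mapping.lookup (pm_scale \<tau> w) \<gamma> = Poly_Mapping.lookup w \<gamma> * monomial_eval \<tau> \<gamma>"
  unfolding pm_scale_def by (rule lookup_subst_scale)

lemma ring_morphism_pm_eval: "ring_morphism (pm_eval \<tau>)"
  by (rule ring_morphism.ring_morphism_subst[OF ring_morphism_id])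

lemma ring_morphism_pm_scale: "ring_morphism (pm_scale \<tau>)"
  unfolding pm_scale_def by (rule ring_morphism.ring_morphism_subst[OF ring_morphism_pm_const])

lemma pm_scale_const [simp]: "pm_scale \<tau> (pm_const a) = pm_const a"
  by (rule poly_mapping_eqI) (auto simp: lookup_pm_scale lookup_single when_def)

lemma pm_scale_pm_scale: "pm_scale \<tau> (pm_scale \<upsilon> w) = pm_scale (\<lambda>l. \<tau> l * \<upsilon> l) w"
  by (rule poly_mapping_eqI) (simp add: lookup_pm_scale monomial_eval_mult algebra_simps)

text \<open>At the all-ones point the translates of a polynomial under a set of scalings take the
  values of that polynomial at the points of the set, and these can be prescribed by
  interpolation.\<close>

lemma pm_eval_pm_scale: "pm_eval (\<lambda>l. 1) (pm_scale \<tau> w) = pm_eval \<tau> w"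
proof -
  interpret e: ring_morphism "pm_eval (\<lambda>l :: 'b. 1 :: 'a)"
    by (rule ring_morphism_pm_eval)
  show ?thesis
    by (simp add: pm_scale_def e.comp_subst ring_morphism.subst_single[OF ring_morphism_id])
qed

text \<open>Lagrange interpolation in several variables. For distinct points, the factor
  \<open>F \<tau> \<tau>'\<close> is 1 at \<open>\<tau>\<close> and 0 at \<open>\<tau>'\<close>, and
  it involves only one variable, taken from a coordinate in which they differ. Thus \<open>w\<close>
  is fixed by every scaling that is trivial in such coordinates.\<close>

lemma interpolation:
  fixes r :: "('v \<Rightarrow> 'k::field) \<Rightarrow> 'k"
  assumes "finite T"
  obtains w where "\<And>\<tau>. \<tau> \<in> T \<Longrightarrow> pm_eval \<tau> w = r \<tau>"
    "\<And>\<upsilon>. (\<And>l \<tau> \<tau>'. \<tau> \<in> T \<Longrightarrow> \<tau>' \<in> T \<Longrightarrow> \<tau> l \<noteq> \<tau>' l \<Longrightarrow> \<upsilon> l = 1) \<Longrightarrow> pm_scale \<upsilon> w = w"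
proof -
  define l :: "('v \<Rightarrow> 'k) \<Rightarrow> ('v \<Rightarrow> 'k) \<Rightarrow> 'v" where "l \<tau> \<tau>' = (SOME l. \<tau> l \<noteq> \<tau>' l)" for \<tau> \<tau>'
  have l: "\<tau> (l \<tau> \<tau>') \<noteq> \<tau>' (l \<tau> \<tau>')" if "\<tau> \<noteq> \<tau>'" for \<tau> \<tau>'
    unfolding l_def
    by (rule someI_ex[where P = "\<lambda>l. \<tau> l \<noteq> \<tau>' l"]) (use that in \<open>auto simp: fun_eq_iff\<close>)
  define F :: "('v \<Rightarrow> 'k) \<Rightarrow> ('v \<Rightarrow> 'k) \<Rightarrow> ('v \<Rightarrow>\<^sub>0 nat) \<Rightarrow>\<^sub>0 'k" where
    "F \<tau> \<tau>' = pm_const (inverse (\<tau> (l \<tau> \<tau>') - \<tau>' (l \<tau> \<tau>'))) * (pm_var (l \<tau> \<tau>') + pm_const (- \<tau>' (l \<tau> \<tau>')))"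
    for \<tau> \<tau>'
  define w :: "('v \<Rightarrow>\<^sub>0 nat) \<Rightarrow>\<^sub>0 'k" where "w = (\<Sum>\<tau>\<in>T. pm_const (r \<tau>) * (\<Prod>\<tau>'\<in>T - {\<tau>}. F \<tau> \<tau>'))"
  have eval: "pm_eval \<sigma> w = r \<sigma>" if \<sigma>: "\<sigma> \<in> T" for \<sigma>
  proof -
    interpret e: ring_morphism "pm_eval \<sigma>"
      by (rule ring_morphism_pm_eval)
    have F: "pm_eval \<sigma> (F \<tau> \<tau>')
        = inverse (\<tau> (l \<tau> \<tau>') - \<tau>' (l \<tau> \<tau>')) * (\<sigma> (l \<tau> \<tau>') - \<tau>' (l \<tau> \<tau>'))" for \<tau> \<tau>'
      by (simp add: F_def ring_morphism.subst_single[OF ring_morphism_id])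
    have "pm_eval \<sigma> (\<Prod>\<tau>'\<in>T - {\<tau>}. F \<tau> \<tau>') = (if \<tau> = \<sigma> then 1 else 0)" for \<tau>
    proof (cases "\<tau> = \<sigma>")
      case True
      have "pm_eval \<sigma> (F \<sigma> \<tau>') = 1" if "\<tau>' \<noteq> \<sigma>" for \<tau>'
        using l[of \<sigma> \<tau>'] that by (simp add: F)
      then show ?thesis
        using True by (simp add: e.prod)
    next
      case False
      then show ?thesis
        using \<sigma> assms by (auto simp: e.prod F)
    qed
    then show ?thesis
      using \<sigma> assms by (simp add: w_def e.sum sum.delta' ring_morphism.subst_single[OF ring_morphism_id] if_distrib[of "(*) _"] cong: if_cong)
  qed
  have scale: "pm_scale \<upsilon> w = w"
    if \<upsilon>: "\<And>l \<tau> \<tau>'. \<tau> \<in> T \<Longrightarrow> \<tau>' \<in> T \<Longrightarrow> \<tau> l \<noteq> \<tau>' l \<Longrightarrow> \<upsilon> l = 1" for \<upsilon>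
  proof -
    interpret s: ring_morphism "pm_scale \<upsilon>"
      by (rule ring_morphism_pm_scale)
    have "pm_scale \<upsilon> (F \<tau> \<tau>') = F \<tau> \<tau>'" if "\<tau> \<in> T" "\<tau>' \<in> T - {\<tau>}" for \<tau> \<tau>'
    proof -
      have "\<upsilon> (l \<tau> \<tau>') = 1"
        using \<upsilon> l that by (metis Diff_iff singletonI)
      then have "pm_scale \<upsilon> (pm_var (l \<tau> \<tau>')) = pm_var (l \<tau> \<tau>')"
        by (intro poly_mapping_eqI) (auto simp: lookup_pm_scale lookup_single when_def)
      then show ?thesis
        by (simp add: F_def)
    qed
    then show ?thesis
      by (simp add: w_def s.sum s.prod)
  qed
  from eval scale show ?thesis
    by (rule that)
qed


section \<open>Tuples of roots of unity\<close>

text \<open>The polynomial \<open>X ^ d - 1\<close> splits. A double root would also be a root of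
  its derivative, hence 0 since \<open>d\<close> is nonzero in the field; but 0 is not a
  root.\<close>

lemma card_roots_of_unity:
  assumes "of_nat d \<noteq> (0 :: 'a::alg_closed_field)"
  shows "card {x :: 'a. x ^ d = 1} = d"
proof -
  have d: "d > 0"
    using assms by (cases d) auto
  define p :: "'a poly" where "p = monom 1 d - 1"
  have deg: "degree p = d"
    unfolding p_def diff_conv_add_uminus
    using d by (subst degree_add_eq_left) (simp_all add: degree_monom_eq)
  have "lead_coeff p = 1"
    unfolding deg using d by (simp add: p_def)
  then obtain xs where xs: "length xs = d" "p = (\<Prod>x\<leftarrow>xs. [:- x, 1:])"
    using alg_closed_splits deg by metis
  have roots: "{x. x ^ d = 1} = set xs"
  proof -
    have "x ^ d = 1 \<longleftrightarrow> poly p x = 0" for x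
      by (simp add: p_def poly_monom)
    also have "\<dots> x \<longleftrightarrow> x \<in> set xs" for x
      unfolding xs(2) by (induction xs) auto
    finally show ?thesis by blast
  qed
  have "distinct xs"
  proof (rule ccontr)
    assume "\<not> distinct xs"
    then obtain as y bs cs where dec: "xs = as @ [y] @ bs @ [y] @ cs"
      using not_distinct_decomp by blast
    define q where "q = (\<Prod>x\<leftarrow>as @ bs @ cs. [:- x, 1:])"
    have "p = [:- y, 1:] * ([:- y, 1:] * q)"
      unfolding xs(2) dec q_def by (simp only: map_append prod_list.append list.map prod_list.Cons ac_simps)
         simp
    then have "poly (pderiv p) y = 0"
      by (simp only: pderiv_mult poly_add poly_mult) simp
    moreover have "poly (pderiv p) y = of_nat d * y ^ (d - 1)"
      by (simp add: p_def pderiv_diff pderiv_monom poly_monom)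
    ultimately have "y = 0"
      using assms by simp
    moreover have "y ^ d = 1"
      using roots dec by auto
    ultimately show False
      using d by (simp add: power_0_left)
  qed
  then show ?thesis
    using roots xs(1) by (simp add: distinct_card)
qed

text \<open>A coordinate with \<open>d l = 1\<close> is forced to be 1. An eventually constant
  \<open>d\<close> of value 1 thus leaves finitely many free coordinates, and two such groups can be
  given disjoint supports.\<close>

definition unity_tuples :: "(nat \<Rightarrow> nat) \<Rightarrow> (nat \<Rightarrow> 'k::monoid_mult) set" where
  "unity_tuples d = {\<tau>. \<forall>l. \<tau> l ^ d l = 1}"

text \<open>All coordinates from \<open>N\<close> on are 1, so restriction to the first
  \<open>N\<close> is a bijection onto a product of groups of roots of unity of orders
  \<open>d l\<close>.\<close>

lemma card_unity_tuples:
  assumes "\<And>l. l \<ge> N \<Longrightarrow> d l = 1" "\<And>l. of_nat (d l) \<noteq> (0 :: 'k::alg_closed_field)"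
  shows "finite (unity_tuples d :: (nat \<Rightarrow> 'k) set)"
    "card (unity_tuples d :: (nat \<Rightarrow> 'k) set) = (\<Prod>l<N. d l)"
proof -
  define P where "P = PiE {..<N} (\<lambda>l. {x :: 'k. x ^ d l = 1})"
  have d: "d l > 0" for l
    using assms(2)[of l] by (cases "d l") auto
  have bij: "bij_betw (\<lambda>\<tau>. restrict \<tau> {..<N}) (unity_tuples d :: (nat \<Rightarrow> 'k) set) P"
  proof (rule bij_betw_byWitness[where f' = "\<lambda>g l. if l < N then g l else 1"])
    show "\<forall>\<tau>\<in>unity_tuples d. (\<lambda>l. if l < N then restrict \<tau> {..<N} l else 1) = (\<tau> :: nat \<Rightarrow> 'k)"
    proof (intro ballI ext)
      fix \<tau> :: "nat \<Rightarrow> 'k" and l assume "\<tau> \<in> unity_tuples d"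
      then have "\<tau> l ^ d l = 1"
        by (simp add: unity_tuples_def)
      then show "(if l < N then restrict \<tau> {..<N} l else 1) = \<tau> l"
        using assms(1)[of l] by (cases "l < N") simp_all
    qed
    show "\<forall>g\<in>P. restrict (\<lambda>l. if l < N then g l else 1) {..<N} = g"
    proof (intro ballI ext)
      fix g l assume "g \<in> P"
      then show "restrict (\<lambda>l. if l < N then g l else 1) {..<N} l = g l"
        using PiE_arb[of g "{..<N}" _ l] by (cases "l < N") (simp_all add: P_def)
    qed
    show "(\<lambda>\<tau>. restrict \<tau> {..<N}) ` unity_tuples d \<subseteq> P"
      by (simp add: P_def unity_tuples_def image_subset_iff)
    show "(\<lambda>g l. if l < N then g l else 1) ` P \<subseteq> unity_tuples d"
    proof (intro image_subsetI)
      fix g assume "g \<in> P"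
      then have "g l ^ d l = 1" if "l < N" for l
        using that unfolding P_def by (auto dest: PiE_mem)
      then show "(\<lambda>l. if l < N then g l else 1) \<in> unity_tuples d"
        by (simp add: unity_tuples_def)
    qed
  qed
  have fin: "finite {x :: 'k. x ^ d l = 1}" for l
    by (rule card_ge_0_finite) (simp add: card_roots_of_unity[OF assms(2)] d)
  then have "finite P"
    unfolding P_def by (intro finite_PiE) auto
  then show "finite (unity_tuples d :: (nat \<Rightarrow> 'k) set)"
    using bij_betw_finite[OF bij] by simp
  have "card P = (\<Prod>l<N. d l)"
    unfolding P_def by (simp add: card_PiE card_roots_of_unity[OF assms(2)])
  then show "card (unity_tuples d :: (nat \<Rightarrow> 'k) set) = (\<Prod>l<N. d l)"
    using bij_betw_same_card[OF bij] by simp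
qed

lemma unity_tuples_mult_bij:
  fixes \<tau> :: "nat \<Rightarrow> 'k::field"
  assumes "\<tau> \<in> unity_tuples d" "\<And>l. d l > 0"
  shows "bij_betw (\<lambda>\<upsilon> l. \<tau> l * \<upsilon> l) (unity_tuples d) (unity_tuples d)"
proof (rule bij_betw_byWitness[where f' = "\<lambda>\<upsilon> l. inverse (\<tau> l) * \<upsilon> l"])
  have "\<tau> l \<noteq> 0" for l
  proof -
    have "\<tau> l ^ d l = 1"
      using assms(1) by (simp add: unity_tuples_def)
    then show ?thesis
      using assms(2)[of l] by (auto simp: zero_power)
  qed
  then show "\<forall>\<upsilon>\<in>unity_tuples d. (\<lambda>l. inverse (\<tau> l) * (\<tau> l * \<upsilon> l)) = \<upsilon>"
    "\<forall>\<upsilon>\<in>unity_tuples d. (\<lambda>l. \<tau> l * (inverse (\<tau> l) * \<upsilon> l)) = \<upsilon>"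
    by (simp_all add: mult.assoc[symmetric])
  show "(\<lambda>\<upsilon> l. \<tau> l * \<upsilon> l) ` unity_tuples d \<subseteq> unity_tuples d"
    "(\<lambda>\<upsilon> l. inverse (\<tau> l) * \<upsilon> l) ` unity_tuples d \<subseteq> unity_tuples d"
    using assms(1) by (auto simp: unity_tuples_def power_mult_distrib power_inverse)
qed


section \<open>Leading monomials\<close>

text \<open>Addition is strictly monotone, so a pair of keys with sum \<open>a + b\<close> can only
  be \<open>a\<close> and \<open>b\<close> themselves. If one of the bounds is not attained, both
  sides of the second claim are 0.\<close>

lemma
  fixes u v :: "'g::{ordered_cancel_comm_monoid_add, linorder} \<Rightarrow>\<^sub>0 'k::semiring_0"
  assumes u: "\<And>\<gamma>. \<gamma> \<in> Poly_Mapping.keys u \<Longrightarrow> \<gamma> \<le> a"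
    and v: "\<And>\<gamma>. \<gamma> \<in> Poly_Mapping.keys v \<Longrightarrow> \<gamma> \<le> b"
  shows keys_mult_le: "\<And>\<gamma>. \<gamma> \<in> Poly_Mapping.keys (u * v) \<Longrightarrow> \<gamma> \<le> a + b"
    and lookup_mult_top:
      "Poly_Mapping.lookup (u * v) (a + b) = Poly_Mapping.lookup u a * Poly_Mapping.lookup v b"
proof -
  fix \<gamma> assume "\<gamma> \<in> Poly_Mapping.keys (u * v)"
  then obtain \<alpha> \<beta> where "\<gamma> = \<alpha> + \<beta>" "\<alpha> \<in> Poly_Mapping.keys u" "\<beta> \<in> Poly_Mapping.keys v"
    using keys_mult[of u v] by blast
  then show "\<gamma> \<le> a + b"
    by (simp add: u v add_mono)
next
  let ?s = "\<lambda>p \<gamma>. Poly_Mapping.single \<gamma> (Poly_Mapping.lookup p \<gamma>)"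
  have top: "\<alpha> + \<beta> = a + b \<longleftrightarrow> \<alpha> = a \<and> \<beta> = b"
    if "\<alpha> \<in> Poly_Mapping.keys u" "\<beta> \<in> Poly_Mapping.keys v" for \<alpha> \<beta>
    using u[OF that(1)] v[OF that(2)] add_less_le_mono[of \<alpha> a \<beta> b] add_le_less_mono[of \<alpha> a \<beta> b]
    by (auto simp: le_less)
  have "u * v = (\<Sum>\<alpha>\<in>Poly_Mapping.keys u. ?s u \<alpha>) * (\<Sum>\<beta>\<in>Poly_Mapping.keys v. ?s v \<beta>)"
    by (simp only: pm_sum_single[symmetric])
  then have "Poly_Mapping.lookup (u * v) (a + b)
      = (\<Sum>\<alpha>\<in>Poly_Mapping.keys u. \<Sum>\<beta>\<in>Poly_Mapping.keys v.
          Poly_Mapping.lookup (?s u \<alpha> * ?s v \<beta>) (a + b))"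
    by (simp only: sum_product lookup_sum)
  also have "\<dots> = (\<Sum>\<alpha>\<in>Poly_Mapping.keys u. if \<alpha> = a then
      (\<Sum>\<beta>\<in>Poly_Mapping.keys v. if \<beta> = b then Poly_Mapping.lookup u \<alpha> * Poly_Mapping.lookup v \<beta> else 0) else 0)"
    by (intro sum.cong refl) (auto simp: mult_single lookup_single when_def top intro!: sum.cong)
  also have "\<dots> = Poly_Mapping.lookup u a * Poly_Mapping.lookup v b"
    by (auto simp: sum.delta in_keys_iff)
  finally show "Poly_Mapping.lookup (u * v) (a + b) = Poly_Mapping.lookup u a * Poly_Mapping.lookup v b" .
qed

text \<open>Exponent vectors themselves form a convolution semiring, in which \<open>of_nat m * \<delta>\<close> is the
  \<open>m\<close>-fold sum of \<open>\<delta>\<close>.\<close>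

lemma of_nat_Suc_mult_exponent: "of_nat (Suc m) * \<delta> = \<delta> + of_nat m * (\<delta> :: nat \<Rightarrow>\<^sub>0 nat)"
  by (simp add: algebra_simps)

lemma
  fixes u :: "(nat \<Rightarrow>\<^sub>0 nat) \<Rightarrow>\<^sub>0 'k::comm_ring_1"
  assumes u: "\<And>\<gamma>. \<gamma> \<in> Poly_Mapping.keys u \<Longrightarrow> \<gamma> \<le> \<delta>"
  shows keys_power_le: "\<And>\<gamma>. \<gamma> \<in> Poly_Mapping.keys (u ^ m) \<Longrightarrow> \<gamma> \<le> of_nat m * \<delta>"
    and lookup_power_top: "Poly_Mapping.lookup (u ^ m) (of_nat m * \<delta>) = Poly_Mapping.lookup u \<delta> ^ m"
proof -
  have "(\<forall>\<gamma>\<in>Poly_Mapping.keys (u ^ m). \<gamma> \<le> of_nat m * \<delta>)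
      \<and> Poly_Mapping.lookup (u ^ m) (of_nat m * \<delta>) = Poly_Mapping.lookup u \<delta> ^ m"
  proof (induction m)
    case 0
    then show ?case by simp
  next
    case (Suc m)
    then have um: "\<gamma> \<le> of_nat m * \<delta>" if "\<gamma> \<in> Poly_Mapping.keys (u ^ m)" for \<gamma>
      using that by blast
    show ?case
      unfolding of_nat_Suc_mult_exponent power_Suc
    proof (intro conjI ballI)
      fix \<gamma> assume "\<gamma> \<in> Poly_Mapping.keys (u * u ^ m)"
      with u um show "\<gamma> \<le> \<delta> + of_nat m * \<delta>"
        by (rule keys_mult_le)
    next
      have "Poly_Mapping.lookup (u * u ^ m) (\<delta> + of_nat m * \<delta>)
          = Poly_Mapping.lookup u \<delta> * Poly_Mapping.lookup (u ^ m) (of_nat m * \<delta>)"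
        using u um by (rule lookup_mult_top)
      with Suc show "Poly_Mapping.lookup (u * u ^ m) (\<delta> + of_nat m * \<delta>)
          = Poly_Mapping.lookup u \<delta> * Poly_Mapping.lookup u \<delta> ^ m"
        by simp
    qed
  qed
  then show "\<And>\<gamma>. \<gamma> \<in> Poly_Mapping.keys (u ^ m) \<Longrightarrow> \<gamma> \<le> of_nat m * \<delta>"
    "Poly_Mapping.lookup (u ^ m) (of_nat m * \<delta>) = Poly_Mapping.lookup u \<delta> ^ m"
    by blast+
qed

lemma of_nat_mult_exponent_strict_mono:
  fixes \<gamma> \<delta> :: "nat \<Rightarrow>\<^sub>0 nat"
  assumes "\<gamma> < \<delta>" "m > 0"
  shows "of_nat m * \<gamma> < of_nat m * \<delta>"
  using assms(2)
proof (induction m rule: nat_induct_non_zero)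
  case 1
  then show ?case using assms(1) by simp
next
  case (Suc m)
  then show ?case
    using assms(1) unfolding of_nat_Suc_mult_exponent by (intro add_strict_mono)
qed

text \<open>This is how a divisibility by \<open>sqf\<close> is exploited: \<open>m\<close>-th roots
  of unity in all coordinates fix the \<open>m\<close>-th power of every monomial.\<close>

lemma monomial_eval_power_eq_1:
  "(\<And>l. \<tau> l ^ m = 1) \<Longrightarrow> monomial_eval \<tau> \<delta> ^ m = 1"
  by (simp add: monomial_eval_def prod_power_distrib flip: power_mult)
     (simp add: mult.commute power_mult)

text \<open>Scaling enlarges no set of keys, so every summand is bounded by
  \<open>of_nat m * \<delta>\<close>. Its top coefficient is that of \<open>w ^ m\<close> times the
  \<open>m\<close>-th power of the eigenvalue of \<open>\<delta>\<close>; where these powers are 1,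
  the contributions are equal and their number is \<open>card T\<close>.\<close>

lemma
  fixes w :: "(nat \<Rightarrow>\<^sub>0 nat) \<Rightarrow>\<^sub>0 'k::field"
  assumes w: "\<And>\<gamma>. \<gamma> \<in> Poly_Mapping.keys w \<Longrightarrow> \<gamma> \<le> \<delta>"
  shows lookup_orbit_sum_gt: "of_nat m * \<delta> < \<gamma> \<Longrightarrow>
      Poly_Mapping.lookup (\<Sum>\<tau>\<in>T. pm_scale \<tau> w ^ m) \<gamma> = 0"
    and lookup_orbit_sum_top: "(\<And>\<tau>. \<tau> \<in> T \<Longrightarrow> monomial_eval \<tau> \<delta> ^ m = 1) \<Longrightarrow>
      Poly_Mapping.lookup (\<Sum>\<tau>\<in>T. pm_scale \<tau> w ^ m) (of_nat m * \<delta>)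
        = of_nat (card T) * Poly_Mapping.lookup w \<delta> ^ m"
proof -
  have keys: "\<gamma> \<le> \<delta>" if "\<gamma> \<in> Poly_Mapping.keys (pm_scale \<tau> w)" for \<gamma> \<tau>
    using that w by (simp add: in_keys_iff lookup_pm_scale)
  have le: "\<gamma> \<le> of_nat m * \<delta>" if "\<gamma> \<in> Poly_Mapping.keys (pm_scale \<tau> w ^ m)" for \<gamma> \<tau>
    using keys that by (rule keys_power_le)
  have top: "Poly_Mapping.lookup (pm_scale \<tau> w ^ m) (of_nat m * \<delta>)
      = (Poly_Mapping.lookup w \<delta> * monomial_eval \<tau> \<delta>) ^ m" for \<tau>
    using keys by (subst lookup_power_top) (simp_all add: lookup_pm_scale)
  show "Poly_Mapping.lookup (\<Sum>\<tau>\<in>T. pm_scale \<tau> w ^ m) \<gamma> = 0" if "of_nat m * \<delta> < \<gamma>"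
  proof -
    have "Poly_Mapping.lookup (pm_scale \<tau> w ^ m) \<gamma> = 0" for \<tau>
      using le[of \<gamma> \<tau>] that by (meson in_keys_iff not_le)
    then show ?thesis
      by (simp add: lookup_sum)
  qed
  assume "\<And>\<tau>. \<tau> \<in> T \<Longrightarrow> monomial_eval \<tau> \<delta> ^ m = 1"
  then show "Poly_Mapping.lookup (\<Sum>\<tau>\<in>T. pm_scale \<tau> w ^ m) (of_nat m * \<delta>)
        = of_nat (card T) * Poly_Mapping.lookup w \<delta> ^ m"
    by (simp add: lookup_sum top power_mult_distrib)
qed

text \<open>The hypotheses on \<open>m1\<close> and \<open>m2\<close> force the leading monomials of \<open>w1\<close> and \<open>w2\<close> to agree.
  The common monomial is fixed by both \<open>T1\<close> and \<open>T2\<close>, so that the leading terms of the two sums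
  survive for both exponents.\<close>

lemma orbit_sums_vanish:
  fixes w1 w2 :: "(nat \<Rightarrow>\<^sub>0 nat) \<Rightarrow>\<^sub>0 'k::field"
  assumes inv1: "\<And>\<upsilon>. \<upsilon> \<in> T2 \<Longrightarrow> pm_scale \<upsilon> w1 = w1"
    and inv2: "\<And>\<upsilon>. \<upsilon> \<in> T1 \<Longrightarrow> pm_scale \<upsilon> w2 = w2"
    and vanish: "\<And>m. m \<in> {m1, m2} \<Longrightarrow>
      (\<Sum>\<tau>\<in>T1. pm_scale \<tau> w1 ^ m) + (\<Sum>\<tau>\<in>T2. pm_scale \<tau> w2 ^ m) = 0"
    and T1: "\<exists>m\<in>{m1, m2}. \<forall>\<tau>\<in>T1. \<forall>l. \<tau> l ^ m = 1"
    and T2: "\<exists>m\<in>{m1, m2}. \<forall>\<tau>\<in>T2. \<forall>l. \<tau> l ^ m = 1"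
    and card: "of_nat (card T1) \<noteq> (0 :: 'k)" "of_nat (card T2) \<noteq> (0 :: 'k)"
    and pos: "m1 > 0" "m2 > 0"
    and nz: "w1 \<noteq> 0 \<or> w2 \<noteq> 0"
  shows "(- (of_nat (card T2) / of_nat (card T1)) :: 'k) ^ m1 = (- (of_nat (card T2) / of_nat (card T1))) ^ m2"
proof -
  let ?S = "\<lambda>T w m. \<Sum>\<tau>\<in>T. pm_scale \<tau> w ^ m"
  \<comment> \<open>Stated for a general pair, to be used in both orders. Here
    \<open>\<delta>\<close> is the leading exponent of \<open>w\<close>, and the last conjunct says
    that the leading exponent of \<open>w'\<close> is at least \<open>\<delta>\<close>.\<close>
  have leading: "\<exists>\<delta>. w' \<noteq> 0 \<and> (\<forall>\<gamma>\<in>Poly_Mapping.keys w. \<gamma> \<le> \<delta>) \<and> Poly_Mapping.lookup w \<delta> \<noteq> 0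
      \<and> (\<forall>\<epsilon>. (\<forall>\<gamma>\<in>Poly_Mapping.keys w'. \<gamma> \<le> \<epsilon>) \<longrightarrow> \<delta> \<le> \<epsilon>)"
    if w: "w \<noteq> 0" and T: "\<exists>m\<in>{m1, m2}. \<forall>\<tau>\<in>T. \<forall>l. \<tau> l ^ m = 1" and cT: "of_nat (card T) \<noteq> (0 :: 'k)"
      and sum: "\<And>m. m \<in> {m1, m2} \<Longrightarrow> ?S T w m + ?S T' w' m = 0"
    for w w' :: "(nat \<Rightarrow>\<^sub>0 nat) \<Rightarrow>\<^sub>0 'k" and T T'
  proof -
    define \<delta> where "\<delta> = Max (Poly_Mapping.keys w)"
    have keys: "Poly_Mapping.keys w \<noteq> {}"
      using w by (metis empty_iff in_keys_iff lookup_zero poly_mapping_eqI)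
    have \<delta>: "\<gamma> \<le> \<delta>" if "\<gamma> \<in> Poly_Mapping.keys w" for \<gamma>
      using that by (simp add: \<delta>_def)
    have "\<delta> \<in> Poly_Mapping.keys w"
      unfolding \<delta>_def using keys by (intro Max_in) auto
    then have lc: "Poly_Mapping.lookup w \<delta> \<noteq> 0"
      by (simp add: in_keys_iff)
    obtain m where m: "m \<in> {m1, m2}" "\<And>\<tau> l. \<tau> \<in> T \<Longrightarrow> \<tau> l ^ m = 1"
      using T by blast
    have "Poly_Mapping.lookup (?S T w m) (of_nat m * \<delta>) = of_nat (card T) * Poly_Mapping.lookup w \<delta> ^ m"
      using \<delta> m(2) by (intro lookup_orbit_sum_top monomial_eval_power_eq_1)
    then have "Poly_Mapping.lookup (?S T w m) (of_nat m * \<delta>) \<noteq> 0"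
      using lc cT by simp
    moreover have "Poly_Mapping.lookup (?S T w m + ?S T' w' m) (of_nat m * \<delta>) = 0"
      by (simp only: sum[OF m(1)] lookup_zero)
    \<comment> \<open>The leading term of the first orbit sum survives for this \<open>m\<close>, so
      the second one must cancel it.\<close>
    ultimately have ne: "Poly_Mapping.lookup (?S T' w' m) (of_nat m * \<delta>) \<noteq> 0"
      by (simp only: lookup_add) force
    \<comment> \<open>Positivity makes multiplication by \<open>m\<close> strictly monotone on
      exponents, and it excludes \<open>0 ^ 0 = 1\<close> in the case \<open>w' = 0\<close>.\<close>
    have m0: "m > 0"
      using m(1) pos by auto
    have "\<delta> \<le> \<epsilon>" if \<epsilon>: "\<And>\<gamma>. \<gamma> \<in> Poly_Mapping.keys w' \<Longrightarrow> \<gamma> \<le> \<epsilon>" for \<epsilon>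
    proof (rule ccontr)
      assume "\<not> \<delta> \<le> \<epsilon>"
      then have "of_nat m * \<epsilon> < of_nat m * \<delta>"
        using m0 by (intro of_nat_mult_exponent_strict_mono) simp_all
      with \<epsilon> have "Poly_Mapping.lookup (?S T' w' m) (of_nat m * \<delta>) = 0"
        by (rule lookup_orbit_sum_gt)
      with ne show False
        by contradiction
    qed
    moreover have "w' \<noteq> 0"
    proof
      assume "w' = 0"
      moreover have "pm_scale \<tau> 0 = (0 :: (nat \<Rightarrow>\<^sub>0 nat) \<Rightarrow>\<^sub>0 'k)" for \<tau>
        by (rule poly_mapping_eqI) (simp add: lookup_pm_scale)
      ultimately show False
        using ne m0 by (simp add: zero_power)
    qed
    ultimately show ?thesis
      using \<delta> lc by blast
  qed
  have vanish': "?S T2 w2 m + ?S T1 w1 m = 0" if "m \<in> {m1, m2}" for m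
    using vanish[OF that] by (simp add: add.commute)
  have "w1 \<noteq> 0" "w2 \<noteq> 0"
    using nz leading[OF _ T1 card(1) vanish] leading[OF _ T2 card(2) vanish'] by blast+
  from leading[OF this(1) T1 card(1) vanish] obtain \<delta> where
    \<delta>: "\<And>\<gamma>. \<gamma> \<in> Poly_Mapping.keys w1 \<Longrightarrow> \<gamma> \<le> \<delta>" "Poly_Mapping.lookup w1 \<delta> \<noteq> 0" and
    \<delta>_le: "\<And>\<epsilon>. (\<And>\<gamma>. \<gamma> \<in> Poly_Mapping.keys w2 \<Longrightarrow> \<gamma> \<le> \<epsilon>) \<Longrightarrow> \<delta> \<le> \<epsilon>"
    by blast
  from leading[OF \<open>w2 \<noteq> 0\<close> T2 card(2) vanish'] obtain \<epsilon> where
    \<epsilon>: "\<And>\<gamma>. \<gamma> \<in> Poly_Mapping.keys w2 \<Longrightarrow> \<gamma> \<le> \<epsilon>" "Poly_Mapping.lookup w2 \<epsilon> \<noteq> 0" and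
    \<epsilon>_le: "\<And>\<delta>. (\<And>\<gamma>. \<gamma> \<in> Poly_Mapping.keys w1 \<Longrightarrow> \<gamma> \<le> \<delta>) \<Longrightarrow> \<epsilon> \<le> \<delta>"
    by blast
  have "\<delta> = \<epsilon>"
    using \<epsilon>(1) \<delta>(1) by (intro antisym \<delta>_le \<epsilon>_le)
  note \<epsilon> = \<epsilon>[folded this]
  \<comment> \<open>The exponent \<open>\<delta>\<close> is also a key of \<open>w2\<close>, which
    \<open>T1\<close> fixes, so its eigenvalue is already 1 before any power is taken.\<close>
  have fix1: "monomial_eval \<tau> \<delta> ^ m = 1" if "\<tau> \<in> T1" for \<tau> m
    using arg_cong[OF inv2[OF that], of "\<lambda>w. Poly_Mapping.lookup w \<delta>"] \<epsilon>(2) by (simp add: lookup_pm_scale)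
  have fix2: "monomial_eval \<tau> \<delta> ^ m = 1" if "\<tau> \<in> T2" for \<tau> m
    using arg_cong[OF inv1[OF that], of "\<lambda>w. Poly_Mapping.lookup w \<delta>"] \<delta>(2) by (simp add: lookup_pm_scale)
  define u where "u = Poly_Mapping.lookup w1 \<delta> / Poly_Mapping.lookup w2 \<delta>"
  have "u ^ m = - (of_nat (card T2) / of_nat (card T1))" if m: "m \<in> {m1, m2}" for m
  proof -
    have "Poly_Mapping.lookup (?S T1 w1 m) (of_nat m * \<delta>) + Poly_Mapping.lookup (?S T2 w2 m) (of_nat m * \<delta>) = 0"
      by (simp only: vanish[OF m] lookup_zero flip: lookup_add)
    then have "of_nat (card T1) * Poly_Mapping.lookup w1 \<delta> ^ m + of_nat (card T2) * Poly_Mapping.lookup w2 \<delta> ^ m = 0"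
      using lookup_orbit_sum_top[OF \<delta>(1), where T = T1 and m = m]
        lookup_orbit_sum_top[OF \<epsilon>(1), where T = T2 and m = m] fix1 fix2
      by simp
    then show ?thesis
      using \<epsilon>(2) card by (simp add: u_def power_divide field_simps eq_neg_iff_add_eq_0)
  qed
  then show ?thesis
    by (metis insertI1 insertI2 power_mult mult.commute)
qed


section \<open>The generic point of a multi-Kummer algebra\<close>

lemma common_denominator:
  fixes p :: "'a::idom fract poly"
  obtains d q where "d \<noteq> 0" "smult (Fract d 1) p = map_poly (\<lambda>a. Fract a 1) q"
proof -
  interpret F: ring_morphism "\<lambda>a :: 'a. Fract a 1"
    by (rule ring_morphism_Fract)
  have "\<exists>d q. d \<noteq> 0 \<and> smult (Fract d 1) p = map_poly (\<lambda>a. Fract a 1) q"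
  proof (induction p)
    case 0
    show ?case
      by (intro exI[of _ 1] exI[of _ 0]) simp
  next
    case (pCons c p)
    then obtain d q where dq: "d \<noteq> 0" "smult (Fract d 1) p = map_poly (\<lambda>a. Fract a 1) q"
      by blast
    obtain a b where ab: "c = Fract a b" "b \<noteq> 0"
      by (cases c)
    have "Fract (b * d) 1 * c = Fract (d * a) 1"
      using ab by (simp add: eq_fract algebra_simps del: F.mult)
    moreover have "smult (Fract (b * d) 1) p = map_poly (\<lambda>a. Fract a 1) (smult b q)"
      unfolding F.map_poly_smult dq(2)[symmetric] by (simp del: F.mult)
    ultimately have "smult (Fract (b * d) 1) (pCons c p) = map_poly (\<lambda>a. Fract a 1) (pCons (d * a) (smult b q))"
      by (simp del: F.mult)
    moreover have "b * d \<noteq> 0"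
      using ab dq by simp
    ultimately show ?case
      by blast
  qed
  then show ?thesis
    using that by blast
qed

text \<open>Multiplication by \<open>\<upsilon>\<close> permutes \<open>T\<close>, and hence the
  factors.\<close>

lemma prod_orbit_invariant:
  assumes "bij_betw (\<lambda>\<tau> l. \<upsilon> l * \<tau> l) T T"
  shows "(\<Prod>\<tau>\<in>T. [:- pm_scale \<upsilon> (pm_scale \<tau> A), 1:]) = (\<Prod>\<tau>\<in>T. [:- pm_scale \<tau> A, 1:])"
  unfolding pm_scale_pm_scale
  using prod.reindex_bij_betw[OF assms, of "\<lambda>\<tau>. [:- pm_scale \<tau> A, 1:]"] by simp

text \<open>The roots \<open>case_sum (\<lambda>\<tau>. pm_scale \<tau> A1) (\<lambda>\<tau>. pm_scale \<tau> A2)\<close> specialise, when all variables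
  are set to \<open>1\<close>, to independent indeterminates. Hence the coefficients of the polynomial with
  these roots are algebraically independent.\<close>

lemma generic_orbit_polynomial:
  fixes T1 T2 :: "(nat \<Rightarrow> ('k::field, 'n::finite) gen_base alg_closure) set"
  defines "K \<equiv> \<lambda>A1 A2. case_sum (\<lambda>\<tau>. pm_scale \<tau> A1) (\<lambda>\<tau>. pm_scale \<tau> A2)"
  assumes fin: "finite T1" "finite T2" and card: "card T1 + card T2 = CARD('n)"
    and bij1: "\<And>\<upsilon>. \<upsilon> \<in> T1 \<Longrightarrow> bij_betw (\<lambda>\<tau> l. \<upsilon> l * \<tau> l) T1 T1"
    and bij2: "\<And>\<upsilon>. \<upsilon> \<in> T2 \<Longrightarrow> bij_betw (\<lambda>\<tau> l. \<upsilon> l * \<tau> l) T2 T2"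
    and disj: "\<And>l. (\<forall>\<tau>\<in>T1. \<tau> l = 1) \<or> (\<forall>\<tau>\<in>T2. \<tau> l = 1)"
  obtains \<phi> :: "('k, 'n) gen_mpoly \<Rightarrow> (nat \<Rightarrow>\<^sub>0 nat) \<Rightarrow>\<^sub>0 ('k, 'n) gen_base alg_closure"
    and A1 A2 where
    "ring_morphism \<phi>" "\<And>q. \<phi> q = 0 \<Longrightarrow> q = 0"
    "\<And>\<upsilon> q. \<upsilon> \<in> T1 \<union> T2 \<Longrightarrow> pm_scale \<upsilon> (\<phi> q) = \<phi> q"
    "\<And>\<upsilon>. \<upsilon> \<in> T2 \<Longrightarrow> pm_scale \<upsilon> A1 = A1" "\<And>\<upsilon>. \<upsilon> \<in> T1 \<Longrightarrow> pm_scale \<upsilon> A2 = A2"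
    "inj_on (K A1 A2) (T1 <+> T2)"
    "\<And>l. \<phi> (pm_var l) = coeff (\<Prod>\<iota>\<in>T1 <+> T2. [:- K A1 A2 \<iota>, 1:]) (CARD('n) - nat_of_index l)"
proof -
  let ?I = "T1 <+> T2"
  define i where "i q = to_ac (Fract q 1)" for q :: "('k, 'n) gen_mpoly"
  have i_inj: "inj i"
    by (rule injI) (simp add: i_def eq_fract)
  interpret i: ring_morphism i
    unfolding i_def by (rule ring_morphism_comp[OF ring_morphism_to_ac ring_morphism_Fract])
  define r where "r l = i (pm_var l)" for l
  have "card ?I = card (UNIV :: 'n var_index set)"
    using fin card by (simp add: card_Plus card_var_index)
  \<comment> \<open>The bijection \<open>b\<close> prescribes which indeterminate each root has to
    specialise to; \<open>A1\<close> and \<open>A2\<close> are then found by interpolation.\<close>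
  then obtain b where b: "bij_betw b ?I (UNIV :: 'n var_index set)"
    using finite_same_card_bij[of ?I UNIV] fin finite_var_index by auto
  obtain A1 where A1: "\<And>\<tau>. \<tau> \<in> T1 \<Longrightarrow> pm_eval \<tau> A1 = r (b (Inl \<tau>))"
    and A1_inv: "\<And>\<upsilon>. (\<And>l \<tau> \<tau>'. \<tau> \<in> T1 \<Longrightarrow> \<tau>' \<in> T1 \<Longrightarrow> \<tau> l \<noteq> \<tau>' l \<Longrightarrow> \<upsilon> l = 1) \<Longrightarrow> pm_scale \<upsilon> A1 = A1"
    using interpolation[OF fin(1), of "\<lambda>\<tau>. r (b (Inl \<tau>))"] by blast
  obtain A2 where A2: "\<And>\<tau>. \<tau> \<in> T2 \<Longrightarrow> pm_eval \<tau> A2 = r (b (Inr \<tau>))"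
    and A2_inv: "\<And>\<upsilon>. (\<And>l \<tau> \<tau>'. \<tau> \<in> T2 \<Longrightarrow> \<tau>' \<in> T2 \<Longrightarrow> \<tau> l \<noteq> \<tau>' l \<Longrightarrow> \<upsilon> l = 1) \<Longrightarrow> pm_scale \<upsilon> A2 = A2"
    using interpolation[OF fin(2), of "\<lambda>\<tau>. r (b (Inr \<tau>))"] by blast
  \<comment> \<open>A coordinate in which two elements of \<open>T1\<close> differ is not constantly
    1 on \<open>T1\<close>, so by \<open>disj\<close> it is 1 on all of \<open>T2\<close>.\<close>
  have inv1: "pm_scale \<upsilon> A1 = A1" if "\<upsilon> \<in> T2" for \<upsilon>
    using disj that by (intro A1_inv) metis
  have inv2: "pm_scale \<upsilon> A2 = A2" if "\<upsilon> \<in> T1" for \<upsilon>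
    using disj that by (intro A2_inv) metis
  define \<alpha> where "\<alpha> = K A1 A2"
  define e :: "((nat \<Rightarrow>\<^sub>0 nat) \<Rightarrow>\<^sub>0 ('k, 'n) gen_base alg_closure) \<Rightarrow> _" where "e = pm_eval (\<lambda>l. 1)"
  interpret e: ring_morphism e
    unfolding e_def by (rule ring_morphism_pm_eval)
  have e_\<alpha>: "e (\<alpha> \<iota>) = r (b \<iota>)" if "\<iota> \<in> ?I" for \<iota>
    using that A1 A2 by (auto simp: \<alpha>_def K_def e_def pm_eval_pm_scale)
  have inj_r: "inj r"
  proof (rule injI)
    fix l l' assume "r l = r l'"
    then have "pm_var l = (pm_var l' :: ('k, 'n) gen_mpoly)"
      unfolding r_def by (rule injD[OF i_inj])
    from arg_cong[OF this, of Poly_Mapping.keys]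
    have "Poly_Mapping.single l 1 = Poly_Mapping.single l' (1 :: nat)"
      by simp
    from arg_cong[OF this, of Poly_Mapping.keys] show "l = l'"
      by simp
  qed
  \<comment> \<open>The roots are distinct because their specialisations are.\<close>
  have "inj_on (\<lambda>\<iota>. e (\<alpha> \<iota>)) ?I"
    using inj_r b by (auto simp: inj_on_def e_\<alpha> bij_betw_def dest: injD)
  then have inj_\<alpha>: "inj_on \<alpha> ?I"
    by (auto simp: inj_on_def)
  define f where "f = (\<Prod>\<iota>\<in>?I. [:- \<alpha> \<iota>, 1:])"
  have "map_poly e f = (\<Prod>\<iota>\<in>?I. [:- r (b \<iota>), 1:])"
    unfolding f_def e.map_poly_prod_linear by (intro prod.cong) (simp_all add: e_\<alpha>)
  also have "\<dots> = (\<Prod>l\<in>UNIV. [:- r l, 1:])"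
    by (rule prod.reindex_bij_betw[OF b])
  finally have e_f: "e (coeff f j) = coeff (\<Prod>l\<in>UNIV. [:- r l, 1:]) j" for j
    by (metis e.coeff_map_poly)
  \<comment> \<open>An element of one group permutes the factors of its own orbit; in the other
    orbit it commutes with the scalings and fixes the base polynomial.\<close>
  have f_inv: "pm_scale \<upsilon> (coeff f j) = coeff f j" if "\<upsilon> \<in> T1 \<union> T2" for \<upsilon> j
  proof -
    interpret s: ring_morphism "pm_scale \<upsilon>"
      by (rule ring_morphism_pm_scale)
    have f: "f = (\<Prod>\<tau>\<in>T1. [:- pm_scale \<tau> A1, 1:]) * (\<Prod>\<tau>\<in>T2. [:- pm_scale \<tau> A2, 1:])"
      unfolding f_def \<alpha>_def K_def using fin by (simp add: prod.Plus comp_def)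
    have comm: "pm_scale \<upsilon> (pm_scale \<tau> A) = pm_scale \<tau> (pm_scale \<upsilon> A)" for \<tau> A
      by (simp add: pm_scale_pm_scale mult.commute)
    have "(\<Prod>\<tau>\<in>T1. [:- pm_scale \<upsilon> (pm_scale \<tau> A1), 1:]) = (\<Prod>\<tau>\<in>T1. [:- pm_scale \<tau> A1, 1:])"
    proof (cases "\<upsilon> \<in> T1")
      case True
      then show ?thesis by (rule prod_orbit_invariant[OF bij1])
    next
      case False
      then show ?thesis using that by (simp add: comm inv1)
    qed
    moreover have "(\<Prod>\<tau>\<in>T2. [:- pm_scale \<upsilon> (pm_scale \<tau> A2), 1:]) = (\<Prod>\<tau>\<in>T2. [:- pm_scale \<tau> A2, 1:])"
    proof (cases "\<upsilon> \<in> T2")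
      case True
      then show ?thesis by (rule prod_orbit_invariant[OF bij2])
    next
      case False
      then show ?thesis using that by (simp add: comm inv2)
    qed
    ultimately have "map_poly (pm_scale \<upsilon>) f = f"
      unfolding f s.map_poly_mult s.map_poly_prod_linear by (simp only:)
    then show ?thesis
      by (metis s.coeff_map_poly)
  qed
  define \<phi> where "\<phi> = subst (\<lambda>a :: 'k. pm_const (i (pm_const a))) (\<lambda>l :: 'n var_index. coeff f (CARD('n) - nat_of_index l))"
  interpret c: ring_morphism "\<lambda>a :: 'k. pm_const (i (pm_const a)) :: (nat \<Rightarrow>\<^sub>0 nat) \<Rightarrow>\<^sub>0 ('k, 'n) gen_base alg_closure"
    by (intro ring_morphism_comp[OF ring_morphism_pm_const] ring_morphism_comp[OF i.ring_morphism_axioms]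
        ring_morphism_pm_const)
  show ?thesis
  proof (rule that[of \<phi> A1 A2])
    show "ring_morphism \<phi>"
      unfolding \<phi>_def by (rule c.ring_morphism_subst)
    \<comment> \<open>At the all-ones point the coefficients of \<open>f\<close> become those of the
      polynomial with independent roots \<open>r l\<close>, for which injectivity is known.\<close>
    show "q = 0" if "\<phi> q = 0" for q
    proof (rule subst_elementary_symmetric_eq_0[of q, folded i_def])
      have e_const: "e (pm_const a) = a" for a
        by (simp add: e_def ring_morphism.subst_single[OF ring_morphism_id])
      have "e (\<phi> q) = 0"
        using that by simp
      then show "subst (\<lambda>a. i (pm_const a))
          (\<lambda>l. coeff (\<Prod>l\<in>UNIV. [:- i (pm_var l), 1:]) (CARD('n) - nat_of_index l)) q = 0"
        unfolding \<phi>_def e.comp_subst e_f e_const r_def .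
    qed
    show "pm_scale \<upsilon> (\<phi> q) = \<phi> q" if "\<upsilon> \<in> T1 \<union> T2" for \<upsilon> q
      unfolding \<phi>_def ring_morphism.comp_subst[OF ring_morphism_pm_scale] f_inv[OF that] pm_scale_const ..
    show "\<phi> (pm_var l) = coeff (\<Prod>\<iota>\<in>?I. [:- K A1 A2 \<iota>, 1:]) (CARD('n) - nat_of_index l)" for l
      unfolding \<phi>_def c.subst_var f_def \<alpha>_def ..
    show "inj_on (K A1 A2) ?I"
      using inj_\<alpha> unfolding \<alpha>_def .
  qed (simp_all add: inv1 inv2)
qed


section \<open>Prime factorisations of the two degrees, and the nonexistence of solutions\<close>

lemma sqf_prime_list:
  assumes "n > 0"
  obtains ps where "prod_list ps = n" "\<And>p. p \<in> set ps \<Longrightarrow> p dvd n \<and> p dvd sqf n"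
proof -
  obtain ps where ps: "mset ps = prime_factorization n"
    using ex_mset by blast
  have "prod_list ps = n"
    using assms by (simp add: prod_mset_prod_list[symmetric] ps prod_mset_prime_factorization_nat)
  moreover have "p dvd n \<and> p dvd sqf n" if "p \<in> set ps" for p
  proof -
    have "p \<in> prime_factors n"
      using that ps by (metis set_mset_mset)
    then show ?thesis
      by (auto simp: sqf_def intro: dvd_prod_eqI)
  qed
  ultimately show ?thesis
    by (rule that)
qed

text \<open>The first \<open>M\<close> coordinates are left trivial to make room for another group.
  In the induction the new prime goes to coordinate \<open>N\<close>, the first one known to be
  free.\<close>

lemma exponents_of_prime_list:
  fixes M :: nat
  shows "\<exists>d N. N \<ge> M \<and> (\<forall>l<M. d l = 1) \<and> (\<forall>l\<ge>N. d l = 1) \<and> (\<Prod>l<N. d l) = prod_list ps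
    \<and> (\<forall>l. d l \<in> insert 1 (set ps))"
proof (induction ps)
  case Nil
  show ?case
    by (intro exI[of _ "\<lambda>_. 1"] exI[of _ M]) simp
next
  case (Cons p ps)
  then obtain d N where d: "N \<ge> M" "\<forall>l<M. d l = 1" "\<forall>l\<ge>N. d l = 1" "(\<Prod>l<N. d l) = prod_list ps"
    "\<forall>l. d l \<in> insert 1 (set ps)"
    by blast
  have "(\<Prod>l<Suc N. (d(N := p)) l) = p * prod_list ps"
    using d(4) by (simp add: mult.commute)
  with d show ?case
    by (intro exI[of _ "d(N := p)"] exI[of _ "Suc N"]) auto
qed

lemma gen_class_power: "gen_class p ^ m = gen_class (p ^ m)"
  by (induction m) (simp_all add: one_gen_ext.abs_eq times_gen_ext.abs_eq)

theorem theorem1p7: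
  fixes n1 n2 m1 m2 :: nat
  assumes "n1 > 0" and "n2 > 0" and "m1 > 0" and "m2 > 0"
    and "CARD('n::finite) = n1 + n2"
    and "of_nat (n1 * n2) \<noteq> (0 :: 'k::field)"
    and "(- (of_nat n2 / of_nat n1) :: 'k) powi (int m2 - int m1) \<noteq> 1"
    and "sqf n1 dvd m1 \<or> sqf n1 dvd m2"
    and "sqf n2 dvd m1 \<or> sqf n2 dvd m2"
  shows "\<not> (\<exists>x :: ('k, 'n) gen_ext. x \<noteq> 0 \<and> gen_trace (x ^ m1) = 0 \<and> gen_trace (x ^ m2) = 0)"
proof
  assume "\<exists>x :: ('k, 'n) gen_ext. x \<noteq> 0 \<and> gen_trace (x ^ m1) = 0 \<and> gen_trace (x ^ m2) = 0"
  then obtain x :: "('k, 'n) gen_ext" where x: "x \<noteq> 0"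
    and tr_x: "\<And>m. m \<in> {m1, m2} \<Longrightarrow> gen_trace (x ^ m) = 0"
    by blast
  let ?ac = "\<lambda>a :: 'k. to_ac (Fract (pm_const a) 1) :: ('k, 'n) gen_base alg_closure"
  interpret ac: ring_morphism ?ac
    by (intro ring_morphism_comp[OF ring_morphism_to_ac] ring_morphism_comp[OF ring_morphism_Fract]
        ring_morphism_pm_const)
  have ac_eq_0: "?ac a = 0 \<longleftrightarrow> a = 0" for a
    by (simp add: Fract_eq_0_iff) (metis single_zero lookup_single_eq lookup_zero)
  have n_nz: "of_nat n1 \<noteq> (0 :: 'k)" "of_nat n2 \<noteq> (0 :: 'k)"
    using assms(6) by auto
  have of_nat_nz: "of_nat p \<noteq> (0 :: ('k, 'n) gen_base alg_closure)" if "p dvd n" "of_nat n \<noteq> (0 :: 'k)" for p n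
  proof -
    have "of_nat p \<noteq> (0 :: 'k)"
      using that by (auto elim!: dvdE)
    then show ?thesis
      using ac_eq_0 ac.of_nat by metis
  qed

  \<comment> \<open>Primes are listed with multiplicity: the product of the groups of roots of unity
    has order \<open>n1\<close>, while the order of each of its elements divides
    \<open>sqf n1\<close>.\<close>
  obtain ps1 where ps1: "prod_list ps1 = n1" "\<And>p. p \<in> set ps1 \<Longrightarrow> p dvd n1 \<and> p dvd sqf n1"
    using sqf_prime_list[OF assms(1)] by blast
  obtain ps2 where ps2: "prod_list ps2 = n2" "\<And>p. p \<in> set ps2 \<Longrightarrow> p dvd n2 \<and> p dvd sqf n2"
    using sqf_prime_list[OF assms(2)] by blast
  obtain d1 and N1 :: nat where d1: "\<forall>l\<ge>N1. d1 l = 1" "(\<Prod>l<N1. d1 l) = prod_list ps1"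
    "\<forall>l. d1 l \<in> insert 1 (set ps1)"
    using exponents_of_prime_list[of 0 ps1] by blast
  \<comment> \<open>Starting at \<open>N1\<close> makes the two groups act on disjoint sets of
    variables.\<close>
  obtain d2 and N2 :: nat where d2: "\<forall>l<N1. d2 l = 1" "\<forall>l\<ge>N2. d2 l = 1"
    "(\<Prod>l<N2. d2 l) = prod_list ps2" "\<forall>l. d2 l \<in> insert 1 (set ps2)"
    using exponents_of_prime_list[of N1 ps2] by blast
  have dvd: "d1 l dvd n1 \<and> d1 l dvd sqf n1" "d2 l dvd n2 \<and> d2 l dvd sqf n2" for l
    using d1(3)[rule_format, of l] d2(4)[rule_format, of l] ps1(2) ps2(2) by auto
  define T1 :: "(nat \<Rightarrow> ('k, 'n) gen_base alg_closure) set" where "T1 = unity_tuples d1"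
  define T2 :: "(nat \<Rightarrow> ('k, 'n) gen_base alg_closure) set" where "T2 = unity_tuples d2"
  have d_nz: "of_nat (d1 l) \<noteq> (0 :: ('k, 'n) gen_base alg_closure)"
    "of_nat (d2 l) \<noteq> (0 :: ('k, 'n) gen_base alg_closure)" for l
    using of_nat_nz[of "d1 l" n1] of_nat_nz[of "d2 l" n2] dvd[of l] n_nz by simp_all
  have d_pos: "d1 l > 0" "d2 l > 0" for l
    using dvd[of l] assms(1,2) by (auto intro: dvd_pos_nat)
  have T1: "finite T1" "card T1 = n1"
    using card_unity_tuples[OF d1(1)[rule_format] d_nz(1)] d1(2) ps1(1) by (simp_all add: T1_def)
  have T2: "finite T2" "card T2 = n2"
    using card_unity_tuples[OF d2(2)[rule_format] d_nz(2)] d2(3) ps2(1) by (simp_all add: T2_def)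
  have T1_power: "\<tau> l ^ m = 1" if "\<tau> \<in> T1" "d1 l dvd m" for \<tau> l m
    using that by (auto simp: T1_def unity_tuples_def power_mult elim!: dvdE)
  have T2_power: "\<tau> l ^ m = 1" if "\<tau> \<in> T2" "d2 l dvd m" for \<tau> l m
    using that by (auto simp: T2_def unity_tuples_def power_mult elim!: dvdE)
  have T1_1: "\<tau> l = 1" if "\<tau> \<in> T1" "l \<ge> N1" for \<tau> l
    using T1_power[OF that(1), of l 1] d1(1) that(2) by simp
  have T2_1: "\<tau> l = 1" if "\<tau> \<in> T2" "l < N1" for \<tau> l
    using T2_power[OF that(1), of l 1] d2(1) that(2) by simp

  have card: "card T1 + card T2 = CARD('n)"
    using T1 T2 assms(5) by simp
  have bij1: "bij_betw (\<lambda>\<tau> l. \<upsilon> l * \<tau> l) T1 T1" if "\<upsilon> \<in> T1" for \<upsilon>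
    using that d_pos unfolding T1_def by (intro unity_tuples_mult_bij)
  have bij2: "bij_betw (\<lambda>\<tau> l. \<upsilon> l * \<tau> l) T2 T2" if "\<upsilon> \<in> T2" for \<upsilon>
    using that d_pos unfolding T2_def by (intro unity_tuples_mult_bij)
  have disj: "(\<forall>\<tau>\<in>T1. \<tau> l = 1) \<or> (\<forall>\<tau>\<in>T2. \<tau> l = 1)" for l
    using T1_1 T2_1 by (cases "l < N1") simp_all
  show False
  proof (rule generic_orbit_polynomial[OF T1(1) T2(1) card bij1 bij2 disj])
    fix \<phi> :: "('k, 'n) gen_mpoly \<Rightarrow> (nat \<Rightarrow>\<^sub>0 nat) \<Rightarrow>\<^sub>0 ('k, 'n) gen_base alg_closure"
      and A1 A2
    assume \<phi>: "ring_morphism \<phi>" "\<And>q. \<phi> q = 0 \<Longrightarrow> q = 0"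
        "\<And>\<upsilon> q. \<upsilon> \<in> T1 \<union> T2 \<Longrightarrow> pm_scale \<upsilon> (\<phi> q) = \<phi> q"
      and A: "\<And>\<upsilon>. \<upsilon> \<in> T2 \<Longrightarrow> pm_scale \<upsilon> A1 = A1" "\<And>\<upsilon>. \<upsilon> \<in> T1 \<Longrightarrow> pm_scale \<upsilon> A2 = A2"
      and inj: "inj_on (case_sum (\<lambda>\<tau>. pm_scale \<tau> A1) (\<lambda>\<tau>. pm_scale \<tau> A2)) (T1 <+> T2)"
      and var: "\<And>l. \<phi> (pm_var l) = coeff (\<Prod>\<iota>\<in>T1 <+> T2.
        [:- case_sum (\<lambda>\<tau>. pm_scale \<tau> A1) (\<lambda>\<tau>. pm_scale \<tau> A2) \<iota>, 1:]) (CARD('n) - nat_of_index l)"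
    define \<alpha> where \<alpha>: "\<alpha> = case_sum (\<lambda>\<tau>. pm_scale \<tau> A1) (\<lambda>\<tau>. pm_scale \<tau> A2)"
    note inj_\<alpha> = inj[folded \<alpha>] and \<phi>_var = var[folded \<alpha>]
    let ?I = "T1 <+> T2"
    have I: "finite ?I" "card ?I = CARD('n)"
      using T1 T2 assms(5) by (simp_all add: card_Plus)
    interpret \<phi>: ring_morphism \<phi> by (rule \<phi>(1))

    let ?F = "\<lambda>a :: (nat \<Rightarrow>\<^sub>0 nat) \<Rightarrow>\<^sub>0 ('k, 'n) gen_base alg_closure. Fract a 1"
    interpret F: ring_morphism ?F by (rule ring_morphism_Fract)
    interpret G: ring_morphism "\<lambda>a :: ('k, 'n) gen_mpoly. Fract a 1" by (rule ring_morphism_Fract)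
    \<comment> \<open>Injectivity of \<open>\<phi>\<close> is what allows the specialisation to
      extend to the fraction field.\<close>
    have "ring_morphism (\<lambda>q. ?F (\<phi> q))" "\<And>q. ?F (\<phi> q) = 0 \<Longrightarrow> q = 0"
      using \<phi>(2) by (auto simp: Fract_eq_0_iff intro: ring_morphism_comp[OF F.ring_morphism_axioms \<phi>(1)])
    then obtain h where "ring_morphism h" and h_Fract: "\<And>a b. b \<noteq> 0 \<Longrightarrow> h (Fract a b) = ?F (\<phi> a) / ?F (\<phi> b)"
      using ring_morphism_fract_extension by blast
    interpret h: ring_morphism h by fact
    have h: "h (Fract a 1) = ?F (\<phi> a)" for a
      by (simp add: h_Fract)
    have split: "map_poly h gen_poly = (\<Prod>\<iota>\<in>?I. [:- ?F (\<alpha> \<iota>), 1:])"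
    proof (rule map_gen_poly_eqI[OF h.ring_morphism_axioms])
      show "degree (\<Prod>\<iota>\<in>?I. [:- ?F (\<alpha> \<iota>), 1:]) = CARD('n)"
        by (rule trans[OF prod_linear_monic(1)[OF I(1)] I(2)])
      show "lead_coeff (\<Prod>\<iota>\<in>?I. [:- ?F (\<alpha> \<iota>), 1:]) = 1"
        by (rule prod_linear_monic(2)[OF I(1)])
      show "h (Fract (pm_var l) 1) = coeff (\<Prod>\<iota>\<in>?I. [:- ?F (\<alpha> \<iota>), 1:]) (CARD('n) - nat_of_index l)" for l
        unfolding h \<phi>_var F.coeff_map_poly[symmetric] F.map_poly_prod_linear ..
    qed
    have inj_F\<alpha>: "inj_on (\<lambda>\<iota>. ?F (\<alpha> \<iota>)) ?I"
      using inj_\<alpha> by (auto simp: inj_on_def eq_fract)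

    \<comment> \<open>The reduced representative has degree below the number of roots, so its
      specialisation cannot vanish at all of them.\<close>
    define p where "p = rep_gen_ext x mod gen_poly"
    have x_p: "x = gen_class p"
      unfolding p_def
      by (metis Quotient3_abs_rep[OF Quotient3_gen_ext] gen_ext.abs_eq_iff dvd_minus_mod)
    have p: "p \<noteq> 0"
      using x x_p by (metis zero_gen_ext_def)
    have deg_p: "degree p < CARD('n)"
      using degree_mod_less[OF gen_poly_nonzero, of "rep_gen_ext x"] by (auto simp: p_def degree_gen_poly)
    \<comment> \<open>With denominators cleared, \<open>\<phi>\<close> sends the coefficients to
      polynomials, which have leading monomials. The factor \<open>D\<close> does not affect the
      vanishing of traces of powers.\<close>
    obtain D P where D: "D \<noteq> 0" and P: "smult (Fract D 1) p = map_poly (\<lambda>a. Fract a 1) P"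
      using common_denominator .
    have D': "Fract D 1 \<noteq> 0"
      using D by (simp add: Fract_eq_0_iff)
    have "degree P = degree (map_poly (\<lambda>a. Fract a 1) P)"
      by (rule degree_map_poly[symmetric]) (simp add: Fract_eq_0_iff)
    then have deg_P: "degree P < CARD('n)"
      using deg_p D' by (simp flip: P)
    have P_nz: "P \<noteq> 0"
      using P p D' by auto

    \<comment> \<open>Up to the image of \<open>D\<close>, \<open>W\<close> evaluates the
      specialised solution at a root. The pair of polynomials is \<open>W A1\<close> and
      \<open>W A2\<close>, and the values at the other roots are their translates by
      \<open>W_scale\<close>.\<close>
    define W where "W = poly (map_poly \<phi> P)"
    have W_scale: "pm_scale \<upsilon> (W a) = W (pm_scale \<upsilon> a)" if "\<upsilon> \<in> T1 \<union> T2" for \<upsilon> a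
    proof -
      interpret s: ring_morphism "pm_scale \<upsilon>"
        by (rule ring_morphism_pm_scale)
      have "map_poly (pm_scale \<upsilon>) (map_poly \<phi> P) = map_poly \<phi> P"
        by (rule poly_eqI) (simp add: \<phi>(3)[OF that])
      then show ?thesis
        unfolding W_def by (metis s.poly_map_poly)
    qed
    have eval_p: "h (Fract D 1) * poly (map_poly h p) (?F a) = ?F (W a)" for a
    proof -
      have "h (Fract D 1) * poly (map_poly h p) (?F a) = poly (map_poly h (map_poly (\<lambda>a. Fract a 1) P)) (?F a)"
        by (simp add: h.map_poly_smult flip: P)
      also have "map_poly h (map_poly (\<lambda>a. Fract a 1) P) = map_poly ?F (map_poly \<phi> P)"
        by (rule poly_eqI) (simp add: h)
      finally show ?thesis
        by (simp add: F.poly_map_poly W_def)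
    qed
    have sum_W: "(\<Sum>\<iota>\<in>?I. W (\<alpha> \<iota>) ^ m) = 0" if "m \<in> {m1, m2}" for m
    proof -
      have "0 = h (Fract D 1) ^ m * h (gen_trace (x ^ m))"
        by (simp add: tr_x[OF that])
      also have "h (gen_trace (x ^ m)) = (\<Sum>\<iota>\<in>?I. poly (map_poly h (p ^ m)) (?F (\<alpha> \<iota>)))"
        unfolding x_p gen_class_power
        by (rule gen_trace_eq_sum_roots[OF h.ring_morphism_axioms I(1) inj_F\<alpha> split])
      also have "h (Fract D 1) ^ m * \<dots> = (\<Sum>\<iota>\<in>?I. (h (Fract D 1) * poly (map_poly h p) (?F (\<alpha> \<iota>))) ^ m)"
        by (simp only: h.map_poly_power poly_power sum_distrib_left power_mult_distrib)
      also have "\<dots> = ?F (\<Sum>\<iota>\<in>?I. W (\<alpha> \<iota>) ^ m)"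
        by (simp only: eval_p F.sum F.power)
      finally show ?thesis
        by (metis Fract_eq_0_iff)
    qed
    have W_nz: "W A1 \<noteq> 0 \<or> W A2 \<noteq> 0"
    proof (rule ccontr)
      assume *: "\<not> (W A1 \<noteq> 0 \<or> W A2 \<noteq> 0)"
      have scale_0: "pm_scale \<upsilon> 0 = (0 :: (nat \<Rightarrow>\<^sub>0 nat) \<Rightarrow>\<^sub>0 ('k, 'n) gen_base alg_closure)" for \<upsilon>
        by (rule poly_mapping_eqI) (simp add: lookup_pm_scale)
      have "W (\<alpha> \<iota>) = 0" if "\<iota> \<in> ?I" for \<iota>
        using that * by (auto simp: \<alpha> scale_0 simp flip: W_scale)
      moreover have "degree (map_poly \<phi> P) < card ?I"
        using deg_P I(2) map_poly_degree_leq[of \<phi> P] by linarith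
      \<comment> \<open>There are more distinct roots \<open>\<alpha> \<iota>\<close> than the
        degree permits.\<close>
      ultimately have "map_poly \<phi> P = 0"
        unfolding W_def using I(1) inj_\<alpha> by (intro poly_eq_0_if_card_roots)
      then have "\<phi> (coeff P j) = 0" for j
        by (metis \<phi>.coeff_map_poly coeff_0)
      then have "P = 0"
        using \<phi>(2) by (intro poly_eqI) simp
      with P_nz show False ..
    qed

    define q :: 'k where "q = - (of_nat n2 / of_nat n1)"
    have "(- (of_nat (card T2) / of_nat (card T1)) :: ('k, 'n) gen_base alg_closure) ^ m1
        = (- (of_nat (card T2) / of_nat (card T1))) ^ m2"
    proof (rule orbit_sums_vanish[where ?w1.0 = "W A1" and ?w2.0 = "W A2"])
      show "pm_scale \<upsilon> (W A1) = W A1" if "\<upsilon> \<in> T2" for \<upsilon>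
        using that by (simp add: W_scale A)
      show "pm_scale \<upsilon> (W A2) = W A2" if "\<upsilon> \<in> T1" for \<upsilon>
        using that by (simp add: W_scale A)
      show "(\<Sum>\<tau>\<in>T1. pm_scale \<tau> (W A1) ^ m) + (\<Sum>\<tau>\<in>T2. pm_scale \<tau> (W A2) ^ m) = 0"
        if "m \<in> {m1, m2}" for m
        using sum_W[OF that] T1(1) T2(1) by (simp add: sum.Plus \<alpha> W_scale comp_def)
      show "\<exists>m\<in>{m1, m2}. \<forall>\<tau>\<in>T1. \<forall>l. \<tau> l ^ m = 1"
        using assms(8) dvd(1) T1_power by (blast intro: dvd_trans)
      show "\<exists>m\<in>{m1, m2}. \<forall>\<tau>\<in>T2. \<forall>l. \<tau> l ^ m = 1"
        using assms(9) dvd(2) T2_power by (blast intro: dvd_trans)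
      show "of_nat (card T1) \<noteq> (0 :: ('k, 'n) gen_base alg_closure)"
        "of_nat (card T2) \<noteq> (0 :: ('k, 'n) gen_base alg_closure)"
        using of_nat_nz[of n1 n1] of_nat_nz[of n2 n2] n_nz T1 T2 by simp_all
    qed (use assms(3,4) W_nz in auto)
    also have "- (of_nat (card T2) / of_nat (card T1)) = ?ac q"
    proof -
      have "?ac q * of_nat n1 = ?ac (q * of_nat n1)"
        by (simp only: ac.mult ac.of_nat)
      also have "q * of_nat n1 = - of_nat n2"
        using n_nz by (simp add: q_def)
      also have "?ac (- of_nat n2) = - of_nat n2"
        by (simp only: ac.uminus ac.of_nat)
      finally show ?thesis
        using of_nat_nz[of n1 n1] n_nz T1 T2 by (simp add: field_simps)
    qed
    \<comment> \<open>The relation was found in the algebraic closure; the embedding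
      \<open>?ac\<close> is injective, so it descends to the ground field.\<close>
    finally have "?ac (q ^ m1 + - (q ^ m2)) = 0"
      by (simp only: ac.add ac.uminus ac.power) simp
    then have "q ^ m1 = q ^ m2"
      by (simp only: ac_eq_0) simp
    moreover have "q \<noteq> 0"
      using n_nz by (simp add: q_def)
    ultimately have "q powi (int m2 - int m1) = 1"
      by (simp add: power_int_diff)
    with assms(7) show False
      by (simp add: q_def)
  qed
qed

end
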